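(* Let $K$ be a field and let $I\subseteq K[x_1,\ldots,x_n]$ be a nonzero proper monomial ideal with initial degree $\alpha(I)=d$. Let $k$ be the integer with $0\leq k<n$ and $d-1\equiv k \pmod n$. Then $$\alpha(I)\geq\widehat{\alpha}(I)\geq\widetilde{\alpha}(I)\geq\frac{(n+d-1-k)(2n+d-1-k)}{n(2n+d-1-2k)}\geq\left\lfloor\frac{\alpha(I)+n-1}{n}\right\rfloor,$$ where $\widehat{\alpha}(I)$ is the Waldschmidt constant and $\widetilde{\alpha}(I)$ is the naive Waldschmidt constant of $I$.
   Context: Let $R=K[x_1,\ldots,x_n]$. For a nonzero homogeneous ideal $J$, the initial degree $\alpha(J)$ is the least degree of a nonzero element of $J$. Symbolic powers: for $m\ge1$, $I^{(m)}=\bigcap_{P\in\mathrm{Ass}(R/I)}(I^mR_P\cap R)$, where $\mathrm{Ass}(R/I)$ is the set of associated primes of $I$ (including embedded ones). Irreducible powers: a proper monomial ideal is irreducible (not an intersection of two strictly larger ideals) if and only if it is generated by positive powers of some of the variables. Every proper monomial ideal can be written as a finite intersection $I=J_1\cap\cdots\cap J_s$ of irreducible monomial ideals; for $m\geq1$ the $m$-th irreducible power of $I$ is $I^{\{m\}}=J_1^m\cap\cdots\cap J_s^m$ (independent of the chosen decomposition). Waldschmidt constant: $\widehat{\alpha}(I)=\lim_{m\to\infty}\alpha(I^{(m)})/m$. Naive Waldschmidt constant: $\widetilde{\alpha}(I)=\lim_{m\to\infty}\alpha(I^{\{m\}})/m$. Both limits exist. *)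

theory Defs
  imports
    Complex_Main
    "HOL-Library.Cardinality"
    "HOL-Library.Poly_Mapping"
    "HOL-Computational_Algebra.Fraction_Field"
    "HOL-Number_Theory.Cong"
begin

text \<open>
  The ring \<open>K[x\<^sub>1,\<dots>,x\<^sub>n]\<close> is the type of finitely supported maps from exponent vectors to
  coefficients, with variables indexed by a finite type \<open>'n\<close>, so that \<open>n = CARD('n)\<close>. The linear
  order on \<open>'n\<close> only serves to make the library's integral-domain instance applicable, which is
  needed for the field of fractions; no definition depends on it otherwise.
\<close>

type_synonym ('n, 'k) mpoly = "('n \<Rightarrow>\<^sub>0 nat) \<Rightarrow>\<^sub>0 'k"

text \<open>Ideals of a commutative ring are the submodules of the ring over itself.\<close>

global_interpretation ideal: module "(*) :: 'a::comm_ring_1 \<Rightarrow> 'a \<Rightarrow> 'a"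
  by standard (simp_all add: algebra_simps)

definition ideal_mult :: "'a::comm_ring_1 set \<Rightarrow> 'a set \<Rightarrow> 'a set" where
  "ideal_mult I J = ideal.span {a * b | a b. a \<in> I \<and> b \<in> J}"

primrec ideal_power :: "'a::comm_ring_1 set \<Rightarrow> nat \<Rightarrow> 'a set" where
  "ideal_power I 0 = UNIV"
| "ideal_power I (Suc m) = ideal_mult I (ideal_power I m)"

definition is_prime_ideal :: "'a::comm_ring_1 set \<Rightarrow> bool" where
  "is_prime_ideal P \<longleftrightarrow>
     ideal.subspace P \<and> P \<noteq> UNIV \<and> (\<forall>a b. a * b \<in> P \<longrightarrow> a \<in> P \<or> b \<in> P)"

text \<open>The associated primes of \<open>R/I\<close>: the primes that are the annihilator of some class
  \<open>f + I\<close>, where \<open>r\<close> annihilates \<open>f + I\<close> iff \<open>r * f \<in> I\<close>.\<close>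

definition associated_primes :: "'a::comm_ring_1 set \<Rightarrow> 'a set set" where
  "associated_primes I = {P. is_prime_ideal P \<and> (\<exists>f. P = {r. r * f \<in> I})}"

text \<open>For a prime \<open>P\<close> of a domain \<open>R\<close>, the localization \<open>R\<^sub>P\<close> is realized inside the field of
  fractions; \<open>R\<close> is embedded there by \<open>a \<mapsto> Fract a 1\<close>. The ideal \<open>J R\<^sub>P\<close> consists of the
  \<open>R\<^sub>P\<close>-linear combinations of elements of \<open>J\<close>.\<close>

definition localization :: "'a::idom set \<Rightarrow> 'a fract set" where
  "localization P = {Fract a s | a s. s \<notin> P}"

definition localized_ideal :: "'a::idom set \<Rightarrow> 'a set \<Rightarrow> 'a fract set" where
  "localized_ideal P J =
     {\<Sum>a\<in>A. c a * Fract a 1 | A c. finite A \<and> A \<subseteq> J \<and> (\<forall>a\<in>A. c a \<in> localization P)}"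

definition symbolic_power :: "'a::idom set \<Rightarrow> nat \<Rightarrow> 'a set" where
  "symbolic_power I m =
     (\<Inter>P\<in>associated_primes I. {f. Fract f 1 \<in> localized_ideal P (ideal_power I m)})"

definition is_monomial_ideal :: "('n, 'k::comm_ring_1) mpoly set \<Rightarrow> bool" where
  "is_monomial_ideal I \<longleftrightarrow> (\<exists>S. I = ideal.span ((\<lambda>t. Poly_Mapping.single t 1) ` S))"

definition is_irreducible_ideal :: "'a::comm_ring_1 set \<Rightarrow> bool" where
  "is_irreducible_ideal J \<longleftrightarrow>
     ideal.subspace J \<and> J \<noteq> UNIV \<and>
     \<not> (\<exists>A B. ideal.subspace A \<and> ideal.subspace B \<and> J \<subset> A \<and> J \<subset> B \<and> J = A \<inter> B)"

definition is_irreducible_decomposition ::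
    "('n, 'k::comm_ring_1) mpoly set \<Rightarrow> ('n, 'k) mpoly set set \<Rightarrow> bool" where
  "is_irreducible_decomposition I \<J> \<longleftrightarrow>
     finite \<J> \<and> \<J> \<noteq> {} \<and> (\<forall>J\<in>\<J>. is_monomial_ideal J \<and> is_irreducible_ideal J) \<and> I = \<Inter>\<J>"

text \<open>A proper monomial ideal has a decomposition, and the intersection below is the same for all
  of them; the choice operator just picks one, the same for every exponent \<open>m\<close>.\<close>

definition irreducible_power ::
    "('n, 'k::comm_ring_1) mpoly set \<Rightarrow> nat \<Rightarrow> ('n, 'k) mpoly set" where
  "irreducible_power I m =
     (\<Inter>J\<in>(SOME \<J>. is_irreducible_decomposition I \<J>). ideal_power J m)"

definition total_degree :: "('n, 'k::zero) mpoly \<Rightarrow> nat" where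
  "total_degree p = Max ((\<lambda>t. \<Sum>i\<in>Poly_Mapping.keys t. Poly_Mapping.lookup t i) ` Poly_Mapping.keys p)"

definition initial_degree :: "('n, 'k::zero) mpoly set \<Rightarrow> nat" where
  "initial_degree J = (LEAST d. \<exists>f\<in>J. f \<noteq> 0 \<and> total_degree f = d)"

definition waldschmidt_constant ::
    "('n::{finite,linorder}, 'k::field) mpoly set \<Rightarrow> real" where
  "waldschmidt_constant I =
     lim (\<lambda>m. real (initial_degree (symbolic_power I m)) / real m)"

definition naive_waldschmidt_constant ::
    "('n::{finite,linorder}, 'k::field) mpoly set \<Rightarrow> real" where
  "naive_waldschmidt_constant I =
     lim (\<lambda>m. real (initial_degree (irreducible_power I m)) / real m)"

end

theory Submission
  imports Defs
begin

text \<open>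
  Write \<open>w\<^sub>a(t) = \<Sum>\<^sub>i \<lfloor>t\<^sub>i / a\<^sub>i\<rfloor>\<close>. If \<open>J\<close> is generated by the pure powers of the \<open>x\<^sub>i\<close> with exponents \<open>a\<^sub>i\<close>,
  then \<open>J\<^sup>m\<close> is spanned by the monomials \<open>x\<^sup>t\<close> with \<open>w\<^sub>a(t) \<ge> m\<close>. These powers are primary, and
  the radical of a minimal irreducible component \<open>J\<close> of \<open>I\<close> is an associated prime of \<open>I\<close>; hence
  the \<open>m\<close>-th symbolic power lies in the \<open>m\<close>-th irreducible power. Both kinds of powers are
  submultiplicative, so the limits exist by Fekete's lemma, and the first two inequalities
  follow by comparing initial degrees.

  For the third one, let \<open>x\<^sup>t\<close> occur in an element of the \<open>m\<close>-th irreducible power. A vector \<open>b\<close> of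
  degree \<open>d - 1\<close> has \<open>x\<^sup>b \<notin> I\<close>, so some component \<open>J\<close> has all its \<open>a\<^sub>i\<close> at least \<open>b\<^sub>i + 1\<close>, and
  \<open>\<Sum>\<^sub>i t\<^sub>i / (b\<^sub>i + 1) \<ge> m\<close>. With \<open>d - 1 = q n + k\<close>, take \<open>b\<^sub>i = q + 1\<close> at the \<open>k\<close> largest entries
  of \<open>t\<close> and \<open>b\<^sub>i = q\<close> elsewhere.
\<close>

text \<open>For the ring as a module over itself this simp rule is associativity from right to left,
  which loops with \<open>ac_simps\<close> and \<open>algebra_simps\<close>.\<close>
declare ideal.scale_scale [simp del]

section \<open>Powers of ideals and localization\<close>

lemma subspace_ideal_power [simp]: "ideal.subspace (ideal_power I m)"
  by (cases m) (simp_all add: ideal_mult_def)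

lemma mult_mem_ideal_mult: "a \<in> I \<Longrightarrow> b \<in> J \<Longrightarrow> a * b \<in> ideal_mult I J"
  unfolding ideal_mult_def by (rule ideal.span_base) blast

lemma ideal_mult_subset:
  assumes "ideal.subspace T" "\<And>a b. a \<in> I \<Longrightarrow> b \<in> J \<Longrightarrow> a * b \<in> T"
  shows "ideal_mult I J \<subseteq> T"
  unfolding ideal_mult_def by (rule ideal.span_minimal) (use assms in auto)

lemma ideal_power_mono:
  assumes "I \<subseteq> J"
  shows "ideal_power I m \<subseteq> ideal_power J m"
proof (induction m)
  case (Suc m)
  have "ideal_mult I (ideal_power I m) \<subseteq> ideal_power J (Suc m)"
  proof (rule ideal_mult_subset)
    show "ideal.subspace (ideal_power J (Suc m))" by (rule subspace_ideal_power)
    fix a b assume "a \<in> I" "b \<in> ideal_power I m"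
    then show "a * b \<in> ideal_power J (Suc m)"
      using assms Suc by (simp add: mult_mem_ideal_mult subset_iff)
  qed
  then show ?case by simp
qed simp

lemma mult_mem_ideal_power_add:
  assumes "a \<in> ideal_power I m" "b \<in> ideal_power I k"
  shows "a * b \<in> ideal_power I (m + k)"
  using assms(1)
proof (induction m arbitrary: a)
  case 0
  then show ?case using assms(2) by (simp add: ideal.subspace_scale)
next
  case (Suc m)
  \<comment> \<open>For fixed \<open>b\<close>, the elements that multiply \<open>b\<close> into the
    larger power form an ideal, so only the generating products \<open>c * e\<close> have to be
    checked.\<close>
  have "ideal_mult I (ideal_power I m) \<subseteq> {a. a * b \<in> ideal_power I (Suc m + k)}"
  proof (rule ideal_mult_subset)
    have sub: "ideal.subspace (ideal_power I (Suc (m + k)))" by (rule subspace_ideal_power)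
    show "ideal.subspace {a. a * b \<in> ideal_power I (Suc m + k)}"
      by (rule ideal.subspaceI)
        (auto simp: distrib_right mult.assoc simp del: ideal_power.simps
          intro: ideal.subspace_0[OF sub] ideal.subspace_add[OF sub] ideal.subspace_scale[OF sub])
    fix c e assume "c \<in> I" "e \<in> ideal_power I m"
    then show "c * e \<in> {a. a * b \<in> ideal_power I (Suc m + k)}"
      using Suc.IH by (simp add: mult.assoc mult_mem_ideal_mult)
  qed
  then show ?case using Suc.prems by auto
qed

lemma power_mem_ideal_power: "f \<in> I \<Longrightarrow> f ^ m \<in> ideal_power I m"
  by (induction m) (simp_all add: mult_mem_ideal_mult)

section \<open>Localization at a prime ideal and symbolic powers\<close>

lemma one_notin_prime_ideal: "is_prime_ideal P \<Longrightarrow> 1 \<notin> P"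
  unfolding is_prime_ideal_def
  by (metis UNIV_eq_I ideal.subspace_scale mult.right_neutral)

lemma zero_in_prime_ideal: "is_prime_ideal P \<Longrightarrow> 0 \<in> P"
  unfolding is_prime_ideal_def by (simp add: ideal.subspace_0)

text \<open>The product of two denominators stays outside \<open>P\<close> because \<open>P\<close>
  is prime, and the numerators over the common denominator stay in the ideal
  \<open>J\<close>.\<close>

lemma localization_sum_common_denominator:
  fixes P J :: "'a::idom set"
  assumes P: "is_prime_ideal P" and J: "ideal.subspace J"
    and "finite A" "A \<subseteq> J" "\<forall>a\<in>A. c a \<in> localization P"
  shows "\<exists>s j. s \<notin> P \<and> j \<in> J \<and> (\<Sum>a\<in>A. c a * Fract a 1) = Fract j s"
  using assms(3-5)
proof (induction A rule: finite_induct)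
  case empty
  show ?case
    using one_notin_prime_ideal[OF P] ideal.subspace_0[OF J]
    by (intro exI[of _ 1] exI[of _ 0]) (simp add: Zero_fract_def)
next
  case (insert x A)
  then obtain s j where sj: "s \<notin> P" "j \<in> J" "(\<Sum>a\<in>A. c a * Fract a 1) = Fract j s"
    by auto
  obtain n s' where n: "c x = Fract n s'" "s' \<notin> P"
    using insert.prems unfolding localization_def by auto
  have nz: "s \<noteq> 0" "s' \<noteq> 0" using sj n zero_in_prime_ideal[OF P] by auto
  have "s * s' \<notin> P" using P sj n unfolding is_prime_ideal_def by blast
  moreover have "(n * s) * x + s' * j \<in> J"
    using insert.prems sj by (intro ideal.subspace_add[OF J] ideal.subspace_scale[OF J]) auto
  moreover have "(\<Sum>a\<in>insert x A. c a * Fract a 1) = Fract ((n * s) * x + s' * j) (s * s')"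
  proof -
    have "(\<Sum>a\<in>insert x A. c a * Fract a 1) = Fract n s' * Fract x 1 + Fract j s"
      by (simp only: sum.insert[OF insert.hyps] n sj)
    also have "\<dots> = Fract (n * x * s + j * s') (s' * s)" using nz by simp
    also have "\<dots> = Fract ((n * s) * x + s' * j) (s * s')" by (simp only: ac_simps)
    finally show ?thesis .
  qed
  ultimately show ?case by blast
qed

text \<open>Cross-multiplying f = j/s in a domain gives s f = j; conversely f is 1/s times the
  element s f of \<open>J\<close>. This reduces symbolic powers to statements inside the
  ring.\<close>

lemma Fract_mem_localized_ideal_iff:
  fixes P J :: "'a::idom set"
  assumes P: "is_prime_ideal P" and J: "ideal.subspace J"
  shows "Fract f 1 \<in> localized_ideal P J \<longleftrightarrow> (\<exists>s. s \<notin> P \<and> s * f \<in> J)"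
proof
  assume "Fract f 1 \<in> localized_ideal P J"
  then obtain s j where sj: "s \<notin> P" "j \<in> J" "Fract f 1 = Fract j s"
    unfolding localized_ideal_def using localization_sum_common_denominator[OF P J]
    by (smt (verit) mem_Collect_eq)
  have "s \<noteq> 0" using sj zero_in_prime_ideal[OF P] by auto
  then have "s * f = j" using sj(3) by (simp add: eq_fract mult.commute)
  then show "\<exists>s. s \<notin> P \<and> s * f \<in> J" using sj by auto
next
  assume "\<exists>s. s \<notin> P \<and> s * f \<in> J"
  then obtain s where s: "s \<notin> P" "s * f \<in> J" by blast
  have "s \<noteq> 0" using s zero_in_prime_ideal[OF P] by auto
  then have "Fract f 1 = (\<Sum>a\<in>{s * f}. Fract 1 s * Fract a 1)" by (simp add: eq_fract)
  moreover have "Fract 1 s \<in> localization P" using s unfolding localization_def by blast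
  ultimately show "Fract f 1 \<in> localized_ideal P J"
    unfolding localized_ideal_def
    by (intro CollectI exI[of _ "{s * f}"] exI[of _ "\<lambda>_. Fract 1 s"]) (use s in auto)
qed

lemma mem_symbolic_power_iff:
  "f \<in> symbolic_power I m \<longleftrightarrow>
    (\<forall>P\<in>associated_primes I. \<exists>s. s \<notin> P \<and> s * f \<in> ideal_power I m)"
  unfolding symbolic_power_def
  by (auto simp: Fract_mem_localized_ideal_iff associated_primes_def)

lemma mult_mem_symbolic_power_add:
  assumes "f \<in> symbolic_power I m" "g \<in> symbolic_power I k"
  shows "f * g \<in> symbolic_power I (m + k)"
  unfolding mem_symbolic_power_iff
proof
  fix P assume P: "P \<in> associated_primes I"
  obtain s where s: "s \<notin> P" "s * f \<in> ideal_power I m"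
    using assms(1) P unfolding mem_symbolic_power_iff by blast
  obtain s' where s': "s' \<notin> P" "s' * g \<in> ideal_power I k"
    using assms(2) P unfolding mem_symbolic_power_iff by blast
  have "s * s' \<notin> P" using P s s' unfolding associated_primes_def is_prime_ideal_def by blast
  moreover have "(s * s') * (f * g) \<in> ideal_power I (m + k)"
    using mult_mem_ideal_power_add[OF s(2) s'(2)] by (simp only: ac_simps)
  ultimately show "\<exists>s. s \<notin> P \<and> s * (f * g) \<in> ideal_power I (m + k)" by blast
qed

text \<open>Supplies the nonzero elements \<open>f ^ m\<close> without which the
  \<open>LEAST\<close> in \<open>initial_degree\<close> would carry no information.\<close>

lemma ideal_power_subset_symbolic_power: "ideal_power I m \<subseteq> symbolic_power I m"
proof
  fix f assume f: "f \<in> ideal_power I m"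
  show "f \<in> symbolic_power I m"
    unfolding mem_symbolic_power_iff
  proof
    fix P assume "P \<in> associated_primes I"
    then have "1 \<notin> P" by (simp add: associated_primes_def one_notin_prime_ideal)
    with f show "\<exists>s. s \<notin> P \<and> s * f \<in> ideal_power I m" by (intro exI[of _ 1]) simp
  qed
qed

section \<open>Initial degrees\<close>

abbreviation "lookup \<equiv> Poly_Mapping.lookup"
abbreviation "keys \<equiv> Poly_Mapping.keys"
abbreviation "single \<equiv> Poly_Mapping.single"

text \<open>The sum runs over all variables, not only over \<open>keys t\<close> as in
  \<open>total_degree\<close>, which makes additivity immediate.\<close>

definition mdeg :: "('n::finite \<Rightarrow>\<^sub>0 nat) \<Rightarrow> nat" where
  "mdeg t = (\<Sum>i\<in>UNIV. lookup t i)"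

lemma mdeg_add: "mdeg (s + t) = mdeg s + mdeg t"
  by (simp add: mdeg_def lookup_add sum.distrib)

lemma total_degree_alt:
  fixes p :: "('n::finite, 'k::zero) mpoly"
  shows "total_degree p = Max (mdeg ` keys p)"
proof -
  have "(\<Sum>i\<in>keys t. lookup t i) = mdeg t" for t :: "'n \<Rightarrow>\<^sub>0 nat"
    unfolding mdeg_def by (rule sum.mono_neutral_left) (auto simp: in_keys_iff)
  then show ?thesis by (simp add: total_degree_def)
qed

lemma mdeg_le_total_degree: "t \<in> keys p \<Longrightarrow> mdeg t \<le> total_degree p"
  by (simp add: total_degree_alt)

lemma total_degree_single [simp]: "c \<noteq> 0 \<Longrightarrow> total_degree (single t c) = mdeg t"
  by (simp add: total_degree_alt)

text \<open>The product has to be nonzero because \<open>Max\<close> of the empty set is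
  unspecified.\<close>

lemma total_degree_mult_le:
  fixes f g :: "('n::finite, 'k::semiring_0) mpoly"
  assumes "f * g \<noteq> 0"
  shows "total_degree (f * g) \<le> total_degree f + total_degree g"
proof -
  have "keys (f * g) \<noteq> {}" using assms by simp
  moreover have "mdeg t \<le> total_degree f + total_degree g" if t: "t \<in> keys (f * g)" for t
  proof -
    obtain a b where "a \<in> keys f" "b \<in> keys g" "t = a + b"
      using t keys_mult[of f g] by blast
    then show ?thesis by (simp add: mdeg_add mdeg_le_total_degree add_mono)
  qed
  ultimately show ?thesis unfolding total_degree_alt[of "f * g"] by simp
qed

lemma initial_degree_le: "f \<in> A \<Longrightarrow> f \<noteq> 0 \<Longrightarrow> initial_degree A \<le> total_degree f"
  unfolding initial_degree_def by (rule Least_le) blast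

lemma initial_degree_attained:
  assumes "f \<in> A" "f \<noteq> 0"
  obtains g where "g \<in> A" "g \<noteq> 0" "total_degree g = initial_degree A"
proof -
  have "\<exists>g\<in>A. g \<noteq> 0 \<and> total_degree g = initial_degree A"
    unfolding initial_degree_def by (rule LeastI_ex) (use assms in blast)
  with that show thesis by blast
qed

lemma initial_degree_antimono:
  assumes "A \<subseteq> B" "f \<in> A" "f \<noteq> 0"
  shows "initial_degree B \<le> initial_degree A"
  using assms by (metis initial_degree_attained initial_degree_le subsetD)

text \<open>In a domain, the product of elements of least degree in \<open>A\<close> and
  \<open>B\<close> is nonzero and so competes for the initial degree of \<open>C\<close>.\<close>

lemma initial_degree_subadditive:
  fixes A B C :: "('n::{finite,linorder}, 'k::idom) mpoly set"
  assumes "f \<in> A" "f \<noteq> 0" "g \<in> B" "g \<noteq> 0"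
    and mult: "\<And>f g. f \<in> A \<Longrightarrow> g \<in> B \<Longrightarrow> f * g \<in> C"
  shows "initial_degree C \<le> initial_degree A + initial_degree B"
proof -
  obtain p where p: "p \<in> A" "p \<noteq> 0" "total_degree p = initial_degree A"
    using initial_degree_attained[OF assms(1,2)] by blast
  obtain q where q: "q \<in> B" "q \<noteq> 0" "total_degree q = initial_degree B"
    using initial_degree_attained[OF assms(3,4)] by blast
  have "p * q \<in> C" "p * q \<noteq> 0" using p q mult by auto
  then show ?thesis
    using initial_degree_le[of "p * q" C] total_degree_mult_le[of p q] p q by linarith
qed

section \<open>Subadditive sequences\<close>

text \<open>Fekete's lemma: writing \<open>m = q p + r\<close> with \<open>r < p\<close> gives \<open>a m \<le> q a p + a r\<close>.\<close>

lemma subadditive_convergent: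
  fixes a :: "nat \<Rightarrow> nat"
  assumes sub: "\<And>m k. a (m + k) \<le> a m + a k"
  shows "convergent (\<lambda>m. real (a m) / real m)"
proof -
  \<comment> \<open>The limit is the infimum of the quotients. Index 0 is left out: its quotient is
    0 by convention and would spoil the infimum.\<close>
  define S where "S = (\<lambda>m. real (a m) / real m) ` {1..}"
  define L where "L = Inf S"
  have bdd: "bdd_below S" unfolding S_def by (rule bdd_belowI[of _ 0]) auto
  have ne: "S \<noteq> {}" unfolding S_def by auto
  have lower: "L \<le> real (a m) / real m" if "m \<ge> 1" for m
    unfolding L_def by (rule cInf_lower) (use that bdd S_def in auto)
  have mult: "a (q * p + r) \<le> q * a p + a r" for q p r
  proof (induction q)
    case (Suc q)
    have "a (Suc q * p + r) \<le> a p + a (q * p + r)" using sub[of p "q * p + r"] by (simp add: add.assoc)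
    then show ?case using Suc by simp
  qed simp
  have "(\<lambda>m. real (a m) / real m) \<longlonglongrightarrow> L"
  proof (rule LIMSEQ_I)
    fix e :: real assume e: "e > 0"
    \<comment> \<open>Half of \<open>e\<close> is spent on an index \<open>p\<close> whose quotient
      is close to \<open>L\<close>; the other half absorbs \<open>C / m\<close>, where
      \<open>C\<close> bounds all remainder terms and \<open>M\<close> is chosen
      accordingly.\<close>
    have "\<exists>x\<in>S. x < L + e / 2"
      using cInf_less_iff[OF ne bdd, of "L + e / 2"] e by (simp add: L_def)
    then obtain p where p: "p \<ge> 1" "real (a p) / real p < L + e / 2" unfolding S_def by auto
    define C where "C = Max (a ` {..<p})"
    have C: "a r \<le> C" if "r < p" for r unfolding C_def by (rule Max_ge) (use that in auto)
    obtain M where M: "real M > 2 * real C / e" using reals_Archimedean2 by blast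
    have "norm (real (a m) / real m - L) < e" if m: "m \<ge> max M 1" for m
    proof -
      define q r where "q = m div p" and "r = m mod p"
      have qr: "m = q * p + r" "r < p" using p unfolding q_def r_def by auto
      have m1: "m \<ge> 1" "M \<le> m" using m by simp_all
      define x where "x = real (a p) / real p"
      have x: "0 \<le> x" "real (a p) = real p * x" using p by (simp_all add: x_def)
      have "a m \<le> q * a p + C" using mult[of q p r, folded qr(1)] C[OF qr(2)] by linarith
      then have "real (a m) \<le> real q * real (a p) + real C" by (simp flip: of_nat_mult of_nat_add)
      also have "\<dots> = real (q * p) * x + real C" using x(2) by simp
      also have "\<dots> \<le> real m * x + real C"
        using qr(1) x(1) by (intro add_right_mono mult_right_mono) simp_all
      finally have "real (a m) / real m \<le> (real m * x + real C) / real m"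
        by (rule divide_right_mono) simp
      also have "\<dots> = x + real C / real m"
        using m1 by (simp add: add_divide_distrib)
      finally have "real (a m) / real m \<le> x + real C / real m" .
      moreover have "real C / real m < e / 2"
      proof -
        have "2 * real C / e < real m" using M m1(2) by linarith
        then have "2 * real C < real m * e" using e by (simp add: pos_divide_less_eq)
        then show ?thesis using m1 by (simp add: field_simps)
      qed
      moreover have "x < L + e / 2" using p(2) by (simp add: x_def)
      ultimately show ?thesis using lower[OF m1(1)] e unfolding real_norm_def by linarith
    qed
    then show "\<exists>no. \<forall>m\<ge>no. norm (real (a m) / real m - L) < e" by blast
  qed
  then show ?thesis unfolding convergent_def by blast
qed

section \<open>Monomial ideals\<close>

definition upset :: "('a::monoid_add) set \<Rightarrow> bool" where
  "upset U \<longleftrightarrow> (\<forall>t\<in>U. \<forall>u. t + u \<in> U)"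

text \<open>For an upset \<open>U\<close> this is the monomial ideal with exponent set
  \<open>U\<close>, so inclusions and intersections of monomial ideals can be decided on exponent
  vectors.\<close>

definition keys_in :: "('n \<Rightarrow>\<^sub>0 nat) set \<Rightarrow> ('n, 'k::zero) mpoly set" where
  "keys_in U = {f. keys f \<subseteq> U}"

lemma keys_times_subset:
  assumes "\<And>a b. a \<in> keys f \<Longrightarrow> b \<in> keys g \<Longrightarrow> a + b \<in> U"
  shows "keys (f * g) \<subseteq> U"
  using keys_mult[of f g] assms by blast

lemma poly_mapping_eq_sum_single: "f = (\<Sum>t\<in>keys f. single t (lookup f t))"
proof (rule poly_mapping_eqI)
  fix s
  have "lookup (\<Sum>t\<in>keys f. single t (lookup f t)) s = (\<Sum>t\<in>keys f. if t = s then lookup f s else 0)"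
    unfolding lookup_sum by (rule sum.cong) (auto simp: lookup_single)
  also have "\<dots> = lookup f s" by (simp add: in_keys_iff)
  finally show "lookup f s = lookup (\<Sum>t\<in>keys f. single t (lookup f t)) s" by simp
qed

lemma subspace_keys_in:
  fixes U :: "('n \<Rightarrow>\<^sub>0 nat) set"
  assumes "upset U"
  shows "ideal.subspace (keys_in U :: ('n, 'k::comm_ring_1) mpoly set)"
proof (rule ideal.subspaceI)
  fix f g c :: "('n, 'k) mpoly"
  assume f: "f \<in> keys_in U"
  show "f + g \<in> keys_in U" if "g \<in> keys_in U"
    using that f keys_add[of f g] by (auto simp: keys_in_def)
  have "keys (f * c) \<subseteq> U"
    by (rule keys_times_subset) (use f assms in \<open>auto simp: keys_in_def upset_def\<close>)
  then show "c * f \<in> keys_in U" by (simp add: keys_in_def mult.commute)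
qed (simp add: keys_in_def)

lemma mem_subspace_of_singles:
  fixes T :: "('n, 'k::comm_ring_1) mpoly set"
  assumes T: "ideal.subspace T" and "\<And>t. t \<in> keys f \<Longrightarrow> single t 1 \<in> T"
  shows "f \<in> T"
proof -
  have "(\<Sum>t\<in>keys f. single t (lookup f t)) \<in> T"
  proof (rule ideal.subspace_sum[OF T])
    fix t assume "t \<in> keys f"
    then have "single 0 (lookup f t) * single t 1 \<in> T"
      using ideal.subspace_scale[OF T] assms(2) by blast
    then show "single t (lookup f t) \<in> T" by (simp add: mult_single)
  qed
  then show ?thesis using poly_mapping_eq_sum_single[of f] by simp
qed

text \<open>The multiples of the generating monomials give the upset; conversely, all monomials of
  an upset serve as generators.\<close>

lemma is_monomial_ideal_iff:
  fixes I :: "('n, 'k::comm_ring_1) mpoly set"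
  shows "is_monomial_ideal I \<longleftrightarrow> (\<exists>U. upset U \<and> I = keys_in U)"
proof
  assume "is_monomial_ideal I"
  then obtain S where S: "I = ideal.span ((\<lambda>t. single t 1) ` S)"
    unfolding is_monomial_ideal_def by blast
  define U where "U = {s + u | s u. s \<in> S}"
  have up: "upset U" unfolding upset_def U_def by (auto simp: add.assoc; blast)
  have "S \<subseteq> U" unfolding U_def by (force intro: add_0_right[symmetric])
  then have "I \<subseteq> keys_in U"
    unfolding S
    by (intro ideal.span_minimal[OF _ subspace_keys_in[OF up]]) (auto simp: keys_in_def)
  moreover have "keys_in U \<subseteq> I"
  proof
    fix f :: "('n, 'k) mpoly" assume "f \<in> keys_in U"
    moreover have "single t 1 \<in> I" if "t \<in> U" for t
    proof -
      obtain s u where t: "t = s + u" "s \<in> S" using \<open>t \<in> U\<close> unfolding U_def by blast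
      have "single u 1 * single s 1 \<in> I"
        unfolding S by (rule ideal.span_scale[OF ideal.span_base[OF imageI[OF t(2)]]])
      then show ?thesis by (simp add: mult_single t add.commute)
    qed
    ultimately show "f \<in> I"
      unfolding S by (auto simp: keys_in_def intro: mem_subspace_of_singles[OF ideal.subspace_span])
  qed
  ultimately show "\<exists>U. upset U \<and> I = keys_in U" using up by blast
next
  assume "\<exists>U. upset U \<and> I = keys_in U"
  then obtain U where U: "upset U" "I = keys_in U" by blast
  have "I = ideal.span ((\<lambda>t. single t 1) ` U)"
  proof
    show "I \<subseteq> ideal.span ((\<lambda>t. single t 1) ` U)"
    proof
      fix f assume "f \<in> I"
      then show "f \<in> ideal.span ((\<lambda>t. single t 1) ` U)"
        unfolding U(2) keys_in_def
        by (intro mem_subspace_of_singles[OF ideal.subspace_span, of f] ideal.span_base) auto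
    qed
    show "ideal.span ((\<lambda>t. single t 1) ` U) \<subseteq> I"
      unfolding U(2) by (rule ideal.span_minimal[OF _ subspace_keys_in[OF U(1)]])
        (auto simp: keys_in_def)
  qed
  then show "is_monomial_ideal I" unfolding is_monomial_ideal_def by blast
qed

lemma keys_in_eq_UNIV_iff:
  assumes "upset U"
  shows "(keys_in U :: ('n, 'k::comm_ring_1) mpoly set) = UNIV \<longleftrightarrow> 0 \<in> U"
proof
  assume "(keys_in U :: ('n, 'k) mpoly set) = UNIV"
  then have "(1 :: ('n, 'k) mpoly) \<in> keys_in U" by simp
  then show "0 \<in> U" by (simp add: keys_in_def)
next
  assume "0 \<in> U"
  then have "U = UNIV" using assms unfolding upset_def by (metis UNIV_eq_I add_0)
  then show "(keys_in U :: ('n, 'k) mpoly set) = UNIV" by (simp add: keys_in_def)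
qed

text \<open>Used to discard the terms that already lie in an ideal and to isolate those of least
  degree.\<close>

lemma keys_split:
  fixes f :: "('n, 'k::comm_ring_1) mpoly"
  obtains g h where "f = g + h" "keys g = keys f \<inter> U" "keys h = keys f - U"
proof -
  define g where "g = (\<Sum>t\<in>keys f \<inter> U. single t (lookup f t))"
  have g: "lookup g s = (if s \<in> U then lookup f s else 0)" for s
  proof -
    have "lookup g s = (\<Sum>t\<in>keys f \<inter> U. if t = s then lookup f s else 0)"
      unfolding g_def lookup_sum by (rule sum.cong) (auto simp: lookup_single)
    then show ?thesis by (auto simp: in_keys_iff)
  qed
  show thesis
    by (rule that[of g "f - g"])
      (auto simp: in_keys_iff g lookup_minus split: if_splits)
qed

text \<open>Translation by \<open>u\<close> is injective, so no two terms collide.\<close>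

lemma keys_mult_single:
  fixes f :: "('n, 'k::comm_ring_1) mpoly"
  shows "keys (f * single u 1) = (\<lambda>t. t + u) ` keys f"
proof -
  have look: "lookup (f * single u 1) (t + u) = lookup f t" for t
  proof -
    have "f * single u 1 = (\<Sum>s\<in>keys f. single s (lookup f s) * single u 1)"
      unfolding sum_distrib_right[symmetric] by (simp flip: poly_mapping_eq_sum_single)
    then have "lookup (f * single u 1) (t + u) =
        lookup (\<Sum>s\<in>keys f. single s (lookup f s) * single u 1) (t + u)" by simp
    also have "\<dots> = (\<Sum>s\<in>keys f. if s = t then lookup f t else 0)"
      unfolding lookup_sum by (rule sum.cong) (auto simp: mult_single lookup_single when_def)
    also have "\<dots> = lookup f t" by (simp add: in_keys_iff)
    finally show ?thesis .
  qed
  show ?thesis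
  proof
    show "keys (f * single u 1) \<subseteq> (\<lambda>t. t + u) ` keys f"
      by (rule keys_times_subset) auto
    show "(\<lambda>t. t + u) ` keys f \<subseteq> keys (f * single u 1)"
      by (auto simp: in_keys_iff look)
  qed
qed

lemma factor_single:
  fixes f :: "('n, 'k::comm_ring_1) mpoly"
  assumes "\<And>t. t \<in> keys f \<Longrightarrow> \<exists>v. t = v + u"
  obtains g where "f = g * single u 1"
proof -
  have "(\<Sum>t\<in>keys f. single (t - u) (lookup f t)) * single u 1 =
      (\<Sum>t\<in>keys f. single t (lookup f t))"
    unfolding sum_distrib_right
  proof (rule sum.cong[OF refl])
    fix t assume "t \<in> keys f"
    then obtain v where "t = v + u" using assms by blast
    then show "single (t - u) (lookup f t) * single u 1 = single t (lookup f t)"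
      by (simp add: mult_single)
  qed
  then have "(\<Sum>t\<in>keys f. single (t - u) (lookup f t)) * single u 1 = f"
    by (simp flip: poly_mapping_eq_sum_single)
  then show thesis by (rule that[OF sym])
qed

section \<open>Ideals generated by pure powers\<close>

text \<open>An exponent \<open>a i = 0\<close> means that no power of the variable \<open>i\<close> occurs among the generators;
  since \<open>x div 0 = 0\<close>, such a variable does not contribute to the weight. The power \<open>J\<^sup>m\<close> of the
  ideal \<open>J\<close> generated by the \<open>x\<^sub>i\<close> to the \<open>a i\<close> with \<open>a i > 0\<close> is spanned by the monomials of
  weight at least \<open>m\<close>.\<close>

definition weight :: "('n::finite \<Rightarrow> nat) \<Rightarrow> ('n \<Rightarrow>\<^sub>0 nat) \<Rightarrow> nat" where
  "weight a t = (\<Sum>i\<in>UNIV. lookup t i div a i)"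

definition pure_ideal :: "('n::finite \<Rightarrow> nat) \<Rightarrow> nat \<Rightarrow> ('n, 'k::zero) mpoly set" where
  "pure_ideal a m = keys_in {t. m \<le> weight a t}"

text \<open>\<open>pure_ideal (radical_exponents a) 1\<close> is the prime generated by the
  variables occurring in \<open>pure_ideal a 1\<close>, that is, its radical;
  \<open>support_degree a\<close> is the degree in these variables.\<close>

definition radical_exponents :: "('n \<Rightarrow> nat) \<Rightarrow> 'n \<Rightarrow> nat" where
  "radical_exponents a i = (if a i = 0 then 0 else 1)"

abbreviation "support_degree a \<equiv> weight (radical_exponents a)"

section \<open>Weights, and powers of ideals generated by pure powers\<close>

lemma weight_add_ge: "weight a s + weight a t \<le> weight a (s + t)"
proof -
  have "x div c + y div c \<le> (x + y) div c" for x y c :: nat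
    using div_add1_eq[of x y c] by linarith
  then have "(\<Sum>i\<in>UNIV. lookup s i div a i + lookup t i div a i) \<le> weight a (s + t)"
    unfolding weight_def lookup_add by (intro sum_mono)
  then show ?thesis by (simp add: weight_def sum.distrib)
qed

lemma weight_mono: "weight a t \<le> weight a (t + u)"
  using weight_add_ge[of a t u] by simp

lemma weight_0 [simp]: "weight a 0 = 0"
  by (simp add: weight_def)

lemma weight_eq_0_iff: "weight a t = 0 \<longleftrightarrow> (\<forall>i. a i > 0 \<longrightarrow> lookup t i < a i)"
  by (auto simp: weight_def div_eq_0_iff)

lemma support_degree_add: "support_degree a (s + t) = support_degree a s + support_degree a t"
  unfolding weight_def sum.distrib[symmetric]
  by (rule sum.cong) (auto simp: radical_exponents_def lookup_add)

lemma support_degree_eq_0_iff: "support_degree a t = 0 \<longleftrightarrow> (\<forall>i. a i > 0 \<longrightarrow> lookup t i = 0)"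
  by (auto simp: weight_eq_0_iff radical_exponents_def)

lemma weight_add_support_degree_0:
  assumes "support_degree a t = 0"
  shows "weight a (s + t) = weight a s"
  unfolding weight_def
proof (rule sum.cong[OF refl])
  fix i
  have "a i = 0 \<or> lookup t i = 0" using assms unfolding support_degree_eq_0_iff by auto
  then show "lookup (s + t) i div a i = lookup s i div a i" by (auto simp: lookup_add)
qed

lemma upset_weight: "upset {t. m \<le> weight a t}"
  by (auto simp: upset_def intro: le_trans[OF _ weight_mono])

lemma subspace_pure_ideal [simp]: "ideal.subspace (pure_ideal a m)"
  unfolding pure_ideal_def by (rule subspace_keys_in[OF upset_weight])

lemma is_monomial_pure_ideal: "is_monomial_ideal (pure_ideal a m)"
  unfolding pure_ideal_def is_monomial_ideal_iff using upset_weight by blast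

lemma mem_pure_ideal_iff: "f \<in> pure_ideal a m \<longleftrightarrow> (\<forall>t\<in>keys f. m \<le> weight a t)"
  by (auto simp: pure_ideal_def keys_in_def)

text \<open>Weights are superadditive. Conversely, a monomial of positive weight has some
  \<open>lookup t i\<close> at least \<open>a i > 0\<close>, and splitting off this pure power
  lowers the weight by exactly 1.\<close>

lemma ideal_power_pure_ideal:
  "ideal_power (pure_ideal a 1 :: ('n::finite, 'k::comm_ring_1) mpoly set) m = pure_ideal a m"
proof (induction m)
  case 0
  show ?case by (auto simp: pure_ideal_def keys_in_def)
next
  case (Suc m)
  let ?J = "pure_ideal a 1 :: ('n, 'k) mpoly set"
  have "ideal_mult ?J (pure_ideal a m) \<subseteq> pure_ideal a (Suc m)"
  proof (rule ideal_mult_subset)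
    fix f g :: "('n, 'k) mpoly"
    assume fg: "f \<in> pure_ideal a 1" "g \<in> pure_ideal a m"
    have "keys (f * g) \<subseteq> {t. Suc m \<le> weight a t}"
    proof (rule keys_times_subset)
      fix s t assume "s \<in> keys f" "t \<in> keys g"
      with fg have "1 \<le> weight a s" "m \<le> weight a t" by (auto simp: mem_pure_ideal_iff)
      then show "s + t \<in> {t. Suc m \<le> weight a t}" using weight_add_ge[of a s t] by simp
    qed
    then show "f * g \<in> pure_ideal a (Suc m)" by (simp add: pure_ideal_def keys_in_def)
  qed simp
  moreover have "pure_ideal a (Suc m) \<subseteq> ideal_mult ?J (pure_ideal a m)"
  proof
    fix f :: "('n, 'k) mpoly" assume f: "f \<in> pure_ideal a (Suc m)"
    show "f \<in> ideal_mult ?J (pure_ideal a m)"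
    proof (rule mem_subspace_of_singles)
      show "ideal.subspace (ideal_mult ?J (pure_ideal a m))" by (simp add: ideal_mult_def)
      fix t assume "t \<in> keys f"
      with f have w: "Suc m \<le> weight a t" by (simp add: mem_pure_ideal_iff)
      then have "weight a t \<noteq> 0" by simp
      then obtain i where i: "a i > 0" "a i \<le> lookup t i" unfolding weight_eq_0_iff using not_le by blast
      define e :: "'n \<Rightarrow>\<^sub>0 nat" where "e = single i (a i)"
      define v where "v = t - e"
      have t: "t = e + v"
        by (rule poly_mapping_eqI)
          (use i in \<open>auto simp: v_def e_def lookup_add lookup_minus lookup_single when_def\<close>)
      have "weight a t = weight a e + weight a v"
      proof -
        have "lookup t j div a j = lookup e j div a j + lookup v j div a j" for j
          using i by (auto simp: t lookup_add e_def lookup_single when_def)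
        then show ?thesis by (simp add: weight_def sum.distrib)
      qed
      moreover have e1: "weight a e = 1"
      proof -
        have "lookup e j div a j = (if j = i then 1 else 0)" for j
          using i by (auto simp: e_def lookup_single when_def)
        then show ?thesis by (simp add: weight_def)
      qed
      ultimately have "single e 1 \<in> ?J" "single v (1::'k) \<in> pure_ideal a m"
        using w by (auto simp: mem_pure_ideal_iff)
      then have "single e 1 * single v 1 \<in> ideal_mult ?J (pure_ideal a m)"
        by (rule mult_mem_ideal_mult)
      then show "single t 1 \<in> ideal_mult ?J (pure_ideal a m)" by (simp add: mult_single t)
    qed
  qed
  ultimately show ?case using Suc by simp
qed

text \<open>The powers of \<open>J\<close> are primary: if \<open>f\<close> has no term in \<open>J\<^sup>m\<close>, multiply the part of \<open>f\<close> of
  least degree in the variables of \<open>J\<close> by the part of \<open>s\<close> that is free of these variables. Its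
  terms cannot cancel, and they have the same weights as the terms of \<open>f\<close>.\<close>

lemma pure_ideal_primary:
  fixes f s :: "('n::{finite,linorder}, 'k::idom) mpoly"
  assumes s: "s \<notin> pure_ideal (radical_exponents a) 1" and sf: "s * f \<in> pure_ideal a m"
  shows "f \<in> pure_ideal a m"
proof (rule ccontr)
  assume nf: "f \<notin> pure_ideal a m"
  obtain fm f' where f: "f = fm + f'" "keys fm = keys f \<inter> {t. m \<le> weight a t}"
      "keys f' = keys f - {t. m \<le> weight a t}"
    using keys_split by metis
  have "keys f' \<noteq> {}" using nf f(3) by (auto simp: mem_pure_ideal_iff)
  have "fm \<in> pure_ideal a m" using f(2) by (auto simp: mem_pure_ideal_iff)
  then have "s * f - s * fm \<in> pure_ideal a m"
    by (rule ideal.subspace_diff[OF subspace_pure_ideal sf ideal.subspace_scale[OF subspace_pure_ideal]])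
  then have sf': "s * f' \<in> pure_ideal a m" by (simp add: f(1) distrib_left)
  define \<mu> where "\<mu> = Min (support_degree a ` keys f')"
  have \<mu>: "\<mu> \<le> support_degree a t" if "t \<in> keys f'" for t using that by (simp add: \<mu>_def)
  have "\<mu> \<in> support_degree a ` keys f'" unfolding \<mu>_def
    using \<open>keys f' \<noteq> {}\<close> by (intro Min_in) auto
  then obtain t0 where t0: "t0 \<in> keys f'" "support_degree a t0 = \<mu>" by auto
  obtain f0 f1 where f': "f' = f0 + f1" "keys f0 = keys f' \<inter> {t. support_degree a t = \<mu>}"
      "keys f1 = keys f' - {t. support_degree a t = \<mu>}"
    using keys_split by metis
  obtain s0 s1 where s': "s = s0 + s1" "keys s0 = keys s \<inter> {t. support_degree a t = 0}"
      "keys s1 = keys s - {t. support_degree a t = 0}"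
    using keys_split by metis
  have "keys s0 \<noteq> {}" using s s'(2) by (auto simp: mem_pure_ideal_iff)
  moreover have "keys f0 \<noteq> {}" using t0 f'(2) by auto
  ultimately have "s0 * f0 \<noteq> 0" by auto
  then obtain t where t: "t \<in> keys (s0 * f0)" by (metis keys_eq_empty equals0I)
  have "keys (s0 * f0) \<subseteq> {t. support_degree a t = \<mu> \<and> weight a t < m}"
  proof (rule keys_times_subset)
    fix u v assume "u \<in> keys s0" "v \<in> keys f0"
    then have "support_degree a u = 0" "support_degree a v = \<mu>" "weight a v < m"
      using s' f' f by auto
    then show "u + v \<in> {t. support_degree a t = \<mu> \<and> weight a t < m}"
      using weight_add_support_degree_0[of a u v] by (simp add: support_degree_add add.commute)
  qed
  with t have t': "support_degree a t = \<mu>" "weight a t < m" by auto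
  \<comment> \<open>Every remaining product has support degree above the minimum, so none of them
    can cancel the term \<open>t\<close> of \<open>s0 * f0\<close>.\<close>
  have "keys (s0 * f1) \<subseteq> {t. \<mu> < support_degree a t}"
  proof (rule keys_times_subset)
    fix u v assume "u \<in> keys s0" "v \<in> keys f1"
    then show "u + v \<in> {t. \<mu> < support_degree a t}"
      using f' \<mu>[of v] by (auto simp: support_degree_add)
  qed
  moreover have "keys (s1 * f') \<subseteq> {t. \<mu> < support_degree a t}"
  proof (rule keys_times_subset)
    fix u v assume "u \<in> keys s1" "v \<in> keys f'"
    then show "u + v \<in> {t. \<mu> < support_degree a t}"
      using s' \<mu>[of v] by (auto simp: support_degree_add)
  qed
  ultimately have "lookup (s0 * f1) t = 0" "lookup (s1 * f') t = 0"
    using t' by (auto simp: in_keys_iff)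
  moreover have "s * f' = s0 * f0 + (s0 * f1 + s1 * f')"
    unfolding s'(1) f'(1) by (simp add: distrib_left distrib_right add.assoc)
  ultimately have "lookup (s * f') t = lookup (s0 * f0) t" by (simp add: lookup_add)
  then have "t \<in> keys (s * f')" using t by (simp add: in_keys_iff)
  then show False using sf' t'(2) by (auto simp: mem_pure_ideal_iff)
qed

lemma radical_exponents_idem [simp]:
  "radical_exponents (radical_exponents a) = radical_exponents a"
  by (simp add: radical_exponents_def fun_eq_iff)

lemma pure_ideal_neq_UNIV [simp]: "pure_ideal a (Suc 0) \<noteq> (UNIV :: ('n::finite, 'k::comm_ring_1) mpoly set)"
  unfolding pure_ideal_def by (subst keys_in_eq_UNIV_iff[OF upset_weight]) simp

text \<open>A primary ideal that equals its own radical is prime: \<open>radical_exponents\<close>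
  is idempotent, so the primary property with \<open>m = 1\<close> applies.\<close>

lemma is_prime_pure_ideal:
  "is_prime_ideal (pure_ideal (radical_exponents a) 1 :: ('n::{finite,linorder}, 'k::idom) mpoly set)"
  unfolding is_prime_ideal_def
  using pure_ideal_primary[of _ "radical_exponents a" _ 1] by auto

section \<open>Irreducible monomial ideals\<close>

lemma upset_leD:
  fixes U :: "('n \<Rightarrow>\<^sub>0 nat) set"
  assumes "upset U" "s \<in> U" "\<And>i. lookup s i \<le> lookup t i"
  shows "t \<in> U"
proof -
  have "t = s + (t - s)"
    by (rule poly_mapping_eqI) (use assms(3) in \<open>simp add: lookup_add lookup_minus\<close>)
  then show ?thesis using assms(1,2) unfolding upset_def by metis
qed

lemma lookup_Abs_finite [simp]: "lookup (Abs_poly_mapping g) i = g i" for g :: "'n::finite \<Rightarrow> 'b::zero"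
  by simp

text \<open>The monomial \<open>x\<^sup>e\<close> generates the socle modulo the pure powers, over the polynomials in the
  variables that do not occur in them.\<close>

lemma larger_ideal_meets_socle:
  fixes A :: "('n::{finite,linorder}, 'k::idom) mpoly set"
  assumes A: "ideal.subspace A" and JA: "pure_ideal a 1 \<subset> A"
  shows "\<exists>g. g \<notin> pure_ideal (radical_exponents a) 1 \<and>
    g * single (Abs_poly_mapping (\<lambda>i. a i - 1)) 1 \<in> A"
proof -
  \<comment> \<open>For an absent variable \<open>a i = 0\<close>, and truncated subtraction gives
    exponent 0.\<close>
  define e where "e = Abs_poly_mapping (\<lambda>i. a i - 1)"
  have e: "lookup e i = a i - 1" for i by (simp add: e_def)
  obtain f where f: "f \<in> A" "f \<notin> pure_ideal a 1" using JA by blast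
  obtain fJ f' where f': "f = fJ + f'" "keys fJ = keys f \<inter> {t. 1 \<le> weight a t}"
      "keys f' = keys f - {t. 1 \<le> weight a t}"
    using keys_split by metis
  have "fJ \<in> A" using f'(2) JA by (auto simp: mem_pure_ideal_iff subset_iff psubset_eq)
  then have "f - fJ \<in> A" using f(1) by (rule ideal.subspace_diff[OF A, rotated])
  then have f'A: "f' \<in> A" by (simp add: f'(1))
  have ne: "keys f' \<noteq> {}" using f(2) f'(3) by (auto simp: mem_pure_ideal_iff)
  have "Min (support_degree a ` keys f') \<in> support_degree a ` keys f'"
    using ne by (intro Min_in) auto
  then obtain t where t: "t \<in> keys f'" "Min (support_degree a ` keys f') = support_degree a t"
    by blast
  have tmin: "support_degree a t \<le> support_degree a s" if "s \<in> keys f'" for s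
    using that t(2) by (metis Min_le finite_imageI finite_keys imageI)
  have "weight a t = 0" using t(1) f'(3) by auto
  then have tlt: "lookup t i < a i" if "a i > 0" for i using that by (simp add: weight_eq_0_iff)
  \<comment> \<open>Multiplying by the monomial of \<open>v\<close> raises \<open>t\<close> to
    \<open>a i - 1\<close> at each occurring variable. Any other term either enters the pure ideal
    or came from an exponent at most \<open>t\<close> there, hence equal to \<open>t\<close> there
    by minimality of the support degree.\<close>
  define v where "v = Abs_poly_mapping (\<lambda>i. a i - 1 - lookup t i)"
  have v: "lookup v i = a i - 1 - lookup t i" for i by (simp add: v_def)
  have pA: "f' * single v 1 \<in> A"
    using ideal.subspace_scale[OF A f'A, of "single v 1"] by (simp only: mult.commute)
  obtain q r where qr: "f' * single v 1 = q + r"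
      "keys q = keys (f' * single v 1) \<inter> {t. 1 \<le> weight a t}"
      "keys r = keys (f' * single v 1) - {t. 1 \<le> weight a t}"
    using keys_split by metis
  have "q \<in> A" using qr(2) JA by (auto simp: mem_pure_ideal_iff subset_iff psubset_eq)
  then have "f' * single v 1 - q \<in> A" using pA by (rule ideal.subspace_diff[OF A, rotated])
  then have rA: "r \<in> A" by (simp add: qr(1))
  have key: "lookup s i = a i - 1" if s: "s \<in> keys r" and i: "a i > 0" for s i
  proof -
    have "s \<in> keys (f' * single v 1)" and w: "weight a s = 0" using s qr(3) by auto
    then obtain t' where t': "s = t' + v" "t' \<in> keys f'" unfolding keys_mult_single by blast
    have le: "lookup t' j \<le> lookup t j" if "a j > 0" for j
    proof -
      have "lookup t' j + (a j - 1 - lookup t j) < a j"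
        using w that unfolding t' weight_eq_0_iff by (simp add: lookup_add v)
      then show ?thesis using tlt[OF that] by linarith
    qed
    have "lookup t' i = lookup t i"
    proof (rule ccontr)
      assume "lookup t' i \<noteq> lookup t i"
      then have "lookup t' i < lookup t i" using le[OF i] by simp
      then have "support_degree a t' < support_degree a t"
        unfolding weight_def
        by (intro sum_strict_mono_ex1) (use le i in \<open>auto simp: radical_exponents_def\<close>)
      then show False using tmin[OF t'(2)] by simp
    qed
    then show ?thesis using tlt[OF i] by (simp add: t' lookup_add v)
  qed
  have "\<exists>w. s = w + e" if "s \<in> keys r" for s
  proof
    show "s = (s - e) + e"
    proof (rule poly_mapping_eqI)
      fix i show "lookup s i = lookup (s - e + e) i"
        using key[OF that, of i] by (cases "a i = 0") (simp_all add: lookup_add lookup_minus e)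
    qed
  qed
  then obtain g where g: "r = g * single e 1" using factor_single[of r e] by blast
  \<comment> \<open>The term of \<open>g\<close> that stems from \<open>t\<close> contains none of
    the variables occurring in the pure ideal.\<close>
  have "g \<notin> pure_ideal (radical_exponents a) 1"
  proof
    assume gP: "g \<in> pure_ideal (radical_exponents a) 1"
    have tv: "lookup (t + v) i < a i" if "a i > 0" for i
      using tlt[OF that] by (simp add: lookup_add v)
    then have "weight a (t + v) = 0" unfolding weight_eq_0_iff by blast
    then have tr: "t + v \<in> keys r" using t(1) by (simp add: qr(3) keys_mult_single)
    then obtain u where u: "t + v = u + e" "u \<in> keys g" unfolding g keys_mult_single by blast
    then have "support_degree a u \<noteq> 0" using gP by (auto simp: mem_pure_ideal_iff)
    then obtain i where i: "a i > 0" "lookup u i \<noteq> 0" unfolding support_degree_eq_0_iff by blast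
    have "lookup u i + (a i - 1) = a i - 1"
      using key[OF tr i(1)] unfolding u(1) by (simp add: lookup_add e)
    then show False using i(2) by simp
  qed
  then show ?thesis using rA unfolding g e_def by blast
qed

text \<open>Two larger ideals contain multiples of the socle monomial by some p and q outside the
  prime. The multiple by \<open>p * q\<close> lies in both, hence in the pure ideal, and the primary
  property puts the socle monomial itself there, although its weight is 0.\<close>

lemma is_irreducible_pure_ideal:
  "is_irreducible_ideal (pure_ideal a 1 :: ('n::{finite,linorder}, 'k::idom) mpoly set)"
proof -
  let ?J = "pure_ideal a 1 :: ('n, 'k) mpoly set"
  let ?P = "pure_ideal (radical_exponents a) 1 :: ('n, 'k) mpoly set"
  let ?x = "single (Abs_poly_mapping (\<lambda>i. a i - 1)) (1::'k)"
  have False if A: "ideal.subspace A" "?J \<subset> A" and B: "ideal.subspace B" "?J \<subset> B"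
    and AB: "?J = A \<inter> B" for A B
  proof -
    obtain p where p: "p \<notin> ?P" "p * ?x \<in> A" using larger_ideal_meets_socle[OF A] by blast
    obtain q where q: "q \<notin> ?P" "q * ?x \<in> B" using larger_ideal_meets_socle[OF B] by blast
    have "q * (p * ?x) \<in> A" "p * (q * ?x) \<in> B"
      by (rule ideal.subspace_scale[OF A(1) p(2)], rule ideal.subspace_scale[OF B(1) q(2)])
    then have "(p * q) * ?x \<in> ?J" using AB by (simp add: ac_simps)
    moreover have "p * q \<notin> ?P"
      using p(1) q(1) is_prime_pure_ideal[of a] unfolding is_prime_ideal_def by blast
    ultimately have "?x \<in> ?J" by (rule pure_ideal_primary[rotated])
    then have "weight a (Abs_poly_mapping (\<lambda>i. a i - 1)) \<noteq> 0" by (simp add: mem_pure_ideal_iff)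
    then show False unfolding weight_eq_0_iff by simp
  qed
  then have "\<not> (\<exists>A B. ideal.subspace A \<and> ideal.subspace B \<and> ?J \<subset> A \<and> ?J \<subset> B \<and> ?J = A \<inter> B)"
    by blast
  then show ?thesis by (simp add: is_irreducible_ideal_def)
qed

text \<open>If the least common multiple of two outside monomials were in the ideal, adjoining each
  monomial separately would give two strictly larger ideals with intersection
  \<open>keys_in U\<close>.\<close>

lemma irreducible_complement_sup_closed:
  fixes U :: "('n::finite \<Rightarrow>\<^sub>0 nat) set"
  assumes U: "upset U" and irr: "is_irreducible_ideal (keys_in U :: ('n, 'k::comm_ring_1) mpoly set)"
    and st: "s \<notin> U" "t \<notin> U"
  shows "Abs_poly_mapping (\<lambda>i. max (lookup s i) (lookup t i)) \<notin> U"
proof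
  let ?m = "Abs_poly_mapping (\<lambda>i. max (lookup s i) (lookup t i))"
  assume m: "?m \<in> U"
  define E where "E s = U \<union> {s + u | u. True}" for s
  have up: "upset (E s)" for s
    using U unfolding upset_def E_def by (auto simp: add.assoc)
  have strict: "(keys_in U :: ('n, 'k) mpoly set) \<subset> keys_in (E s)" if "s \<notin> U" for s
  proof
    show "(keys_in U :: ('n, 'k) mpoly set) \<subseteq> keys_in (E s)"
      unfolding keys_in_def E_def by blast
    have "s \<in> E s" unfolding E_def by (auto intro: add_0_right[symmetric])
    then have "single s (1::'k) \<in> keys_in (E s)" by (simp add: keys_in_def)
    moreover have "single s (1::'k) \<notin> keys_in U" using that by (simp add: keys_in_def)
    ultimately show "(keys_in U :: ('n, 'k) mpoly set) \<noteq> keys_in (E s)" by blast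
  qed
  have "E s \<inter> E t \<subseteq> U"
  proof
    fix x assume x: "x \<in> E s \<inter> E t"
    show "x \<in> U"
    proof (rule ccontr)
      assume "x \<notin> U"
      with x obtain u w where "x = s + u" "x = t + w" unfolding E_def by blast
      then have "lookup s i \<le> lookup x i" "lookup t i \<le> lookup x i" for i
        by (metis lookup_add le_add1)+
      then have "x \<in> U" by (intro upset_leD[OF U m]) simp
      with \<open>x \<notin> U\<close> show False by blast
    qed
  qed
  then have "keys_in U = keys_in (E s) \<inter> (keys_in (E t) :: ('n, 'k) mpoly set)"
    unfolding keys_in_def E_def by blast
  then show False
    using irr strict[OF st(1)] strict[OF st(2)] subspace_keys_in[OF up]
    unfolding is_irreducible_ideal_def by blast
qed

text \<open>A monomial is the least common multiple of its pure powers. If none of these lies in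
  \<open>J\<close>, closure of the complement under least common multiples, applied one variable at
  a time, keeps the monomial outside.\<close>

lemma irreducible_monomial_ideal_is_pure:
  fixes J :: "('n::finite, 'k::comm_ring_1) mpoly set"
  assumes "is_monomial_ideal J" "is_irreducible_ideal J"
  obtains a where "J = pure_ideal a 1"
proof -
  obtain U where U: "upset U" "J = keys_in U" using assms(1) is_monomial_ideal_iff by blast
  have "J \<noteq> UNIV" using assms(2) unfolding is_irreducible_ideal_def by blast
  then have U0: "0 \<notin> U" using U keys_in_eq_UNIV_iff by blast
  define a where "a i = (if \<exists>c. single i c \<in> U then LEAST c. single i c \<in> U else 0)" for i
  have aU: "single i (a i) \<in> U" if "a i > 0" for i
    using that LeastI_ex[of "\<lambda>c. single i c \<in> U"] unfolding a_def by (auto split: if_splits)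
  \<comment> \<open>Positivity uses properness: exponent 0 would put the monomial 1 into
    \<open>J\<close>.\<close>
  have ale: "0 < a i \<and> a i \<le> c" if "single i c \<in> U" for i c
  proof -
    have "a i = (LEAST c. single i c \<in> U)" using that unfolding a_def by auto
    moreover have "single i (LEAST c. single i c \<in> U) \<in> U" by (rule LeastI[of "\<lambda>c. single i c \<in> U", OF that])
    ultimately show ?thesis using Least_le[of "\<lambda>c. single i c \<in> U", OF that] U0
      by (metis gr0I single_zero)
  qed
  have "t \<in> U \<longleftrightarrow> 1 \<le> weight a t" for t
  proof
    assume "1 \<le> weight a t"
    then have "weight a t \<noteq> 0" by simp
    then obtain i where i: "a i > 0" "a i \<le> lookup t i"
      unfolding weight_eq_0_iff using not_le by blast
    show "t \<in> U"
      by (rule upset_leD[OF U(1) aU[OF i(1)]]) (use i in \<open>auto simp: lookup_single when_def\<close>)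
  next
    assume tU: "t \<in> U"
    show "1 \<le> weight a t"
    proof (rule ccontr)
      assume "\<not> 1 \<le> weight a t"
      then have "weight a t = 0" by simp
      then have single: "single i (lookup t i) \<notin> U" for i
        using ale[of i "lookup t i"] unfolding weight_eq_0_iff by (meson not_le)
      have "Abs_poly_mapping (\<lambda>i. if i \<in> F then lookup t i else 0) \<notin> U" if "finite F" for F
        using that
      proof (induction F rule: finite_induct)
        case empty
        show ?case using U0 by simp
      next
        case (insert j F)
        let ?s = "Abs_poly_mapping (\<lambda>i. if i \<in> F then lookup t i else 0)"
        have "Abs_poly_mapping (\<lambda>i. max (lookup ?s i) (lookup (single j (lookup t j)) i)) \<notin> U"
          by (rule irreducible_complement_sup_closed[OF U(1) _ insert.IH single])
            (use assms(2) U(2) in blast)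
        also have "(\<lambda>i. max (lookup ?s i) (lookup (single j (lookup t j)) i)) =
            (\<lambda>i. if i \<in> insert j F then lookup t i else 0)"
          using insert.hyps by (auto simp: fun_eq_iff lookup_single when_def)
        finally show ?case .
      qed
      from this[of UNIV] have "Abs_poly_mapping (lookup t) \<notin> U" by simp
      then show False using tU by (simp add: lookup_inverse)
    qed
  qed
  then have "U = {t. 1 \<le> weight a t}" by blast
  then show thesis using that U(2) unfolding pure_ideal_def by blast
qed

section \<open>Existence of irreducible decompositions\<close>

lemma finite_bounded_functions: "finite {g :: 'n::finite \<Rightarrow> nat. \<forall>i. g i \<le> N}"
  using finite_set_of_finite_funs[of "UNIV :: 'n set" "{..N}" 0] by simp

text \<open>A form of Dickson's lemma.\<close>

lemma truncation_bound:
  fixes V :: "('n::finite \<Rightarrow> nat) set"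
  assumes "finite A" and "\<And>g h. g \<in> V \<Longrightarrow> (\<And>i. g i \<le> h i) \<Longrightarrow> h \<in> V"
  shows "\<exists>N. \<forall>g\<in>V. (\<forall>i. i \<notin> A \<longrightarrow> g i = 0) \<longrightarrow> (\<lambda>i. min (g i) N) \<in> V"
  using assms
proof (induction A arbitrary: V rule: finite_induct)
  case empty
  show ?case
  proof (intro exI[of _ 0] ballI impI)
    fix g :: "'n \<Rightarrow> nat" assume g: "g \<in> V" "\<forall>i. i \<notin> {} \<longrightarrow> g i = 0"
    then have "(\<lambda>i. min (g i) 0) = g" by (simp add: fun_eq_iff)
    then show "(\<lambda>i. min (g i) 0) \<in> V" using g(1) by (rule ssubst[where P = "\<lambda>h. h \<in> V"])
  qed
next
  case (insert x A)
  note up = insert.prems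
  \<comment> \<open>The slices of \<open>V\<close> at height \<open>c\<close> in coordinate
    \<open>x\<close> grow with \<open>c\<close>; \<open>W'\<close> is their union.\<close>
  define W where "W c = {g. g(x := c) \<in> V}" for c
  define W' where "W' = (\<Union>c. W c)"
  have upW: "h \<in> W c" if "g \<in> W c" "\<And>i. g i \<le> h i" for g h c
    unfolding W_def mem_Collect_eq by (rule up[OF that(1)[unfolded W_def mem_Collect_eq]]) (simp add: that(2))
  have upW': "h \<in> W'" if "g \<in> W'" "\<And>i. g i \<le> h i" for g h
  proof -
    obtain c where "g \<in> W c" using \<open>g \<in> W'\<close> unfolding W'_def by blast
    then have "h \<in> W c" by (rule upW) (rule \<open>\<And>i. g i \<le> h i\<close>)
    then show ?thesis unfolding W'_def by blast
  qed
  have Wmono: "g \<in> W c'" if "g \<in> W c" "c \<le> c'" for g c c'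
    unfolding W_def mem_Collect_eq by (rule up[OF that(1)[unfolded W_def mem_Collect_eq]]) (simp add: that(2))
  have "\<exists>N. \<forall>g\<in>W'. (\<forall>i. i \<notin> A \<longrightarrow> g i = 0) \<longrightarrow> (\<lambda>i. min (g i) N) \<in> W'"
    by (rule insert.IH[of W']) (rule upW')
  then obtain N0 where N0: "\<And>g. g \<in> W' \<Longrightarrow> (\<forall>i. i \<notin> A \<longrightarrow> g i = 0) \<Longrightarrow>
      (\<lambda>i. min (g i) N0) \<in> W'"
    by blast
  have "\<exists>N. \<forall>g\<in>W c. (\<forall>i. i \<notin> A \<longrightarrow> g i = 0) \<longrightarrow> (\<lambda>i. min (g i) N) \<in> W c" for c
    by (rule insert.IH[of "W c"]) (rule upW)
  then obtain Nf where Nf: "\<And>c g. g \<in> W c \<Longrightarrow> (\<forall>i. i \<notin> A \<longrightarrow> g i = 0) \<Longrightarrow>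
      (\<lambda>i. min (g i) (Nf c)) \<in> W c"
    by metis
  define G where "G = {g :: 'n \<Rightarrow> nat. \<forall>i. g i \<le> N0} \<inter> W'"
  have finG: "finite G" unfolding G_def using finite_bounded_functions[of N0] by blast
  have "\<exists>c. g \<in> W c" if "g \<in> G" for g using that unfolding G_def W'_def by blast
  then obtain cf where cf: "\<And>g. g \<in> G \<Longrightarrow> g \<in> W (cf g)" by metis
  \<comment> \<open>\<open>G\<close> is finite, so all its members have entered the slice at a
    common height \<open>C\<close>.\<close>
  define C where "C = (\<Sum>g\<in>G. cf g)"
  have C: "g \<in> W C" if "g \<in> G" for g
    using Wmono[OF cf[OF that]] member_le_sum[of g G cf] that finG by (simp add: C_def)
  \<comment> \<open>If \<open>g x\<close> is at least \<open>C\<close>, truncation at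
    \<open>N0\<close> leads into the slice at \<open>C\<close>; each of the finitely many lower
    slices needs only its own bound.\<close>
  define N where "N = N0 + C + (\<Sum>c<C. Nf c)"
  have "(\<lambda>i. min (g i) N) \<in> V" if g: "g \<in> V" "\<forall>i. i \<notin> insert x A \<longrightarrow> g i = 0" for g
  proof -
    define g0 where "g0 = g(x := 0)"
    have g0: "\<forall>i. i \<notin> A \<longrightarrow> g0 i = 0" "g0 \<in> W (g x)"
      using g by (auto simp: g0_def W_def)
    show ?thesis
    proof (cases "C \<le> g x")
      case True
      have "g0 \<in> W'" using g0(2) unfolding W'_def by blast
      then have "(\<lambda>i. min (g0 i) N0) \<in> G" using N0 g0(1) unfolding G_def by auto
      then have "(\<lambda>i. min (g0 i) N0)(x := C) \<in> V" using C unfolding W_def by blast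
      then show ?thesis
        by (rule up) (use True in \<open>auto simp: g0_def N_def\<close>)
    next
      case False
      then have "Nf (g x) \<le> (\<Sum>c<C. Nf c)" by (intro member_le_sum) auto
      then have N: "Nf (g x) \<le> N" "g x \<le> N" using False by (simp_all add: N_def)
      have "(\<lambda>i. min (g0 i) (Nf (g x)))(x := g x) \<in> V" using Nf[OF g0(2,1)] unfolding W_def by blast
      then show ?thesis
        by (rule up) (use N in \<open>auto simp: g0_def\<close>)
    qed
  qed
  then show ?case by blast
qed

text \<open>Membership in \<open>I\<close> depends only on exponents truncated at some
  \<open>N\<close>. Each of the finitely many truncated vectors \<open>g\<close> outside
  \<open>I\<close> gives the component of monomials that do not divide the one of \<open>g\<close>,
  with entries \<open>N\<close> read as infinity.\<close>

lemma irreducible_decomposition_exists: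
  fixes I :: "('n::{finite,linorder}, 'k::idom) mpoly set"
  assumes "is_monomial_ideal I" "I \<noteq> UNIV"
  shows "\<exists>\<J>. is_irreducible_decomposition I \<J>"
proof -
  obtain U where U: "upset U" "I = keys_in U" using assms(1) is_monomial_ideal_iff by blast
  then have U0: "0 \<notin> U" using assms(2) keys_in_eq_UNIV_iff by blast
  define V where "V = {g. Abs_poly_mapping g \<in> U}"
  have up: "h \<in> V" if "g \<in> V" "\<And>i. g i \<le> h i" for g h
    using that upset_leD[OF U(1), of "Abs_poly_mapping g" "Abs_poly_mapping h"]
    unfolding V_def by simp
  have "\<exists>N. \<forall>g\<in>V. (\<forall>i. i \<notin> UNIV \<longrightarrow> g i = 0) \<longrightarrow> (\<lambda>i. min (g i) N) \<in> V"
    by (rule truncation_bound[OF finite]) (rule up)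
  then obtain N where N: "\<And>g. g \<in> V \<Longrightarrow> (\<lambda>i. min (g i) N) \<in> V" by auto
  define G where "G = {g. \<forall>i. g i \<le> N} - V"
  \<comment> \<open>An entry equal to \<open>N\<close> imposes no bound, so that variable gets
    exponent 0 and is absent from the generators.\<close>
  define b where "b g = (\<lambda>i. if g i < N then g i + 1 else 0)" for g :: "'n \<Rightarrow> nat"
  define \<J> where "\<J> = (\<lambda>g. pure_ideal (b g) 1 :: ('n, 'k) mpoly set) ` G"
  have key: "t \<in> U \<longleftrightarrow> (\<forall>g\<in>G. 1 \<le> weight (b g) t)" for t
  proof
    assume "t \<in> U"
    then have tV: "lookup t \<in> V" by (simp add: V_def lookup_inverse)
    show "\<forall>g\<in>G. 1 \<le> weight (b g) t"
    proof (rule ballI, rule ccontr)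
      fix g assume g: "g \<in> G" and "\<not> 1 \<le> weight (b g) t"
      then have "weight (b g) t = 0" by simp
      then have "lookup t i < g i + 1" if "g i < N" for i
        using that unfolding weight_eq_0_iff b_def by (metis less_add_one zero_less_Suc Suc_eq_plus1)
      then have "min (lookup t i) N \<le> g i" for i
        by (cases "g i < N") fastforce+
      then have "g \<in> V" by (rule up[OF N[OF tV]])
      then show False using g by (simp add: G_def)
    qed
  next
    assume all: "\<forall>g\<in>G. 1 \<le> weight (b g) t"
    show "t \<in> U"
    proof (rule ccontr)
      assume "t \<notin> U"
      then have "lookup t \<notin> V" by (simp add: V_def lookup_inverse)
      then have "(\<lambda>i. min (lookup t i) N) \<notin> V" using up[of "\<lambda>i. min (lookup t i) N" "lookup t"] by auto
      then have "(\<lambda>i. min (lookup t i) N) \<in> G" by (simp add: G_def)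
      moreover have "weight (b (\<lambda>i. min (lookup t i) N)) t = 0"
        unfolding weight_eq_0_iff b_def by (auto simp: min_def)
      ultimately show False using all by fastforce
    qed
  qed
  have "finite \<J>"
    unfolding \<J>_def G_def using finite_bounded_functions[of N] by blast
  moreover have "(\<lambda>_. 0) \<in> G" using U0 by (simp add: G_def V_def)
  then have "\<J> \<noteq> {}" unfolding \<J>_def by blast
  moreover have "I = \<Inter>\<J>"
    by (auto simp: U(2) \<J>_def keys_in_def mem_pure_ideal_iff key subset_iff)
  ultimately have "is_irreducible_decomposition I \<J>"
    unfolding is_irreducible_decomposition_def
    using is_monomial_pure_ideal is_irreducible_pure_ideal by (auto simp: \<J>_def)
  then show ?thesis by blast
qed

section \<open>Symbolic powers lie in irreducible powers\<close>

lemma component_is_pure: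
  assumes "is_irreducible_decomposition I \<J>" "K \<in> \<J>"
  obtains a where "K = pure_ideal a 1"
proof (rule irreducible_monomial_ideal_is_pure)
  show "is_monomial_ideal K" "is_irreducible_ideal K"
    using assms unfolding is_irreducible_decomposition_def by auto
qed

text \<open>If \<open>J\<close> is minimal in a decomposition of \<open>I\<close>, then a monomial \<open>x\<^sup>u\<close> in the socle
  modulo \<open>J\<close>, with large exponents at the variables that do not occur in \<open>J\<close>, lies in all other
  components; so \<open>I : x\<^sup>u = J : x\<^sup>u\<close> is the radical of \<open>J\<close>.\<close>

lemma radical_of_minimal_component_associated:
  fixes I :: "('n::{finite,linorder}, 'k::idom) mpoly set"
  assumes dec: "is_irreducible_decomposition I \<J>" and J: "pure_ideal a 1 \<in> \<J>"
    and min: "\<And>K. K \<in> \<J> \<Longrightarrow> K \<subseteq> pure_ideal a 1 \<Longrightarrow> K = pure_ideal a 1"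
  shows "pure_ideal (radical_exponents a) 1 \<in> associated_primes I"
proof -
  let ?J = "pure_ideal a 1 :: ('n, 'k) mpoly set"
  let ?P = "pure_ideal (radical_exponents a) 1 :: ('n, 'k) mpoly set"
  have fin: "finite \<J>" and I: "I = \<Inter>\<J>"
    using dec unfolding is_irreducible_decomposition_def by auto
  have "\<exists>t b. K = pure_ideal b 1 \<and> weight a t = 0 \<and> 1 \<le> weight b t" if K: "K \<in> \<J> - {?J}" for K
  proof -
    obtain b where b: "K = pure_ideal b 1"
      using component_is_pure[OF dec] K by blast
    have "\<not> K \<subseteq> ?J" using K min by blast
    then obtain f where f: "f \<in> K" "f \<notin> ?J" by blast
    then obtain t where "t \<in> keys f" "weight a t = 0" by (auto simp: mem_pure_ideal_iff)
    moreover have "1 \<le> weight b t" using f(1) \<open>t \<in> keys f\<close> by (auto simp: b mem_pure_ideal_iff)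
    ultimately show ?thesis using b by blast
  qed
  then obtain \<tau> \<beta> where \<tau>: "\<And>K. K \<in> \<J> - {?J} \<Longrightarrow>
      K = pure_ideal (\<beta> K) 1 \<and> weight a (\<tau> K) = 0 \<and> 1 \<le> weight (\<beta> K) (\<tau> K)"
    by metis
  \<comment> \<open>At the variables absent from \<open>?J\<close>, the sum dominates every
    \<open>\<tau> K\<close>; at the others, \<open>\<tau> K\<close> is at most
    \<open>a i - 1\<close> because its weight is 0.\<close>
  define u where "u = Abs_poly_mapping
    (\<lambda>i. if a i = 0 then (\<Sum>K\<in>\<J> - {?J}. lookup (\<tau> K) i) else a i - 1)"
  have u: "lookup u i = (if a i = 0 then (\<Sum>K\<in>\<J> - {?J}. lookup (\<tau> K) i) else a i - 1)" for i
    by (simp add: u_def)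
  have uK: "single u 1 \<in> K" if K: "K \<in> \<J> - {?J}" for K
  proof -
    have "lookup (\<tau> K) i \<le> lookup u i" for i
    proof (cases "a i = 0")
      case True
      have "lookup (\<tau> K) i \<le> (\<Sum>K\<in>\<J> - {?J}. lookup (\<tau> K) i)"
        by (rule member_le_sum[OF K]) (use fin in auto)
      then show ?thesis using True by (simp add: u)
    next
      case False
      then have "lookup (\<tau> K) i < a i" using \<tau>[OF K] unfolding weight_eq_0_iff by blast
      then show ?thesis using False by (simp add: u)
    qed
    then have "u \<in> {t. 1 \<le> weight (\<beta> K) t}"
      by (rule upset_leD[OF upset_weight, rotated]) (use \<tau>[OF K] in simp)
    then show ?thesis using \<tau>[OF K]
      by (metis mem_pure_ideal_iff keys_single mem_Collect_eq empty_iff insert_iff)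
  qed
  have "r \<in> ?P \<longleftrightarrow> r * single u 1 \<in> I" for r
  proof -
    have "r * single u 1 \<in> K" if "K \<in> \<J> - {?J}" for K
    proof -
      have "ideal.subspace K" using that \<tau> by (metis subspace_pure_ideal)
      then show ?thesis using uK[OF that] by (rule ideal.subspace_scale)
    qed
    then have "r * single u 1 \<in> I \<longleftrightarrow> r * single u 1 \<in> ?J" using I J by blast
    also have "\<dots> \<longleftrightarrow> (\<forall>t\<in>keys r. weight a (t + u) \<noteq> 0)"
      by (auto simp: mem_pure_ideal_iff keys_mult_single)
    also have "\<dots> \<longleftrightarrow> (\<forall>t\<in>keys r. support_degree a t \<noteq> 0)"
    proof -
      have "weight a (t + u) = 0 \<longleftrightarrow> support_degree a t = 0" for t
      proof -
        have "lookup t i + (a i - 1) < a i \<longleftrightarrow> lookup t i = 0" if "a i > 0" for i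
          using that by linarith
        then show ?thesis unfolding weight_eq_0_iff[of a] support_degree_eq_0_iff
          by (auto simp: lookup_add u)
      qed
      then show ?thesis by simp
    qed
    also have "\<dots> \<longleftrightarrow> r \<in> ?P" by (auto simp: mem_pure_ideal_iff)
    finally show ?thesis by blast
  qed
  then have "?P = {r. r * single u 1 \<in> I}" by blast
  then show ?thesis using is_prime_pure_ideal[of a] unfolding associated_primes_def by blast
qed

text \<open>It suffices to treat a minimal component \<open>K\<close> inside \<open>J\<close>: its
  radical is associated to \<open>I\<close>, so some \<open>s\<close> outside the radical multiplies
  \<open>f\<close> into the \<open>m\<close>-th power of \<open>K\<close>, which is primary.\<close>

lemma symbolic_power_subset_component_power:
  fixes I :: "('n::{finite,linorder}, 'k::idom) mpoly set"
  assumes dec: "is_irreducible_decomposition I \<J>" and J: "J \<in> \<J>"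
  shows "symbolic_power I m \<subseteq> ideal_power J m"
proof
  fix f assume f: "f \<in> symbolic_power I m"
  have "finite \<J>" using dec unfolding is_irreducible_decomposition_def by blast
  then obtain K where K: "K \<in> \<J>" "K \<subseteq> J" "\<And>L. L \<in> \<J> \<Longrightarrow> L \<subseteq> K \<Longrightarrow> L = K"
    using finite_has_minimal2[OF _ J] by metis
  obtain a where a: "K = pure_ideal a 1" using component_is_pure[OF dec K(1)] .
  have "pure_ideal (radical_exponents a) 1 \<in> associated_primes I"
    using radical_of_minimal_component_associated[OF dec] K unfolding a by blast
  then obtain s where s: "s \<notin> pure_ideal (radical_exponents a) 1" "s * f \<in> ideal_power I m"
    using f unfolding mem_symbolic_power_iff by blast
  have "I \<subseteq> K" using dec K(1) unfolding is_irreducible_decomposition_def by blast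
  then have "s * f \<in> ideal_power K m" using s(2) ideal_power_mono by blast
  then have "f \<in> ideal_power K m"
    unfolding a ideal_power_pure_ideal by (rule pure_ideal_primary[OF s(1)])
  then show "f \<in> ideal_power J m" using ideal_power_mono[OF K(2)] by blast
qed

section \<open>The lower bound for the naive Waldschmidt constant\<close>

text \<open>Removing a smallest element never lowers the average; repeating this leaves
  \<open>k\<close> elements. Averages are compared without denominators, so \<open>k = 0\<close> is
  covered.\<close>

lemma subset_above_average:
  fixes y :: "'a \<Rightarrow> real"
  assumes "finite A" "k \<le> card A"
  obtains S where "S \<subseteq> A" "card S = k" "real k * sum y A \<le> real (card A) * sum y S"
proof -
  have "\<exists>S\<subseteq>A. card S = card A - j \<and> real (card S) * sum y A \<le> real (card A) * sum y S"
    if "j \<le> card A" for j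
    using that
  proof (induction j)
    case 0
    show ?case by (intro exI[of _ A]) simp
  next
    case (Suc j)
    then obtain S where S: "S \<subseteq> A" "card S = card A - j"
        "real (card S) * sum y A \<le> real (card A) * sum y S"
      by auto
    define s where "s = real (card S)"
    have finS: "finite S" using S(1) assms(1) finite_subset by blast
    have pos: "card S > 0" using Suc.prems S(2) by simp
    then have "Min (y ` S) \<in> y ` S" by (intro Min_in) (use finS in auto)
    then obtain x where x: "x \<in> S" "y x = Min (y ` S)" by force
    have "(\<Sum>i\<in>S. y x) \<le> sum y S" by (rule sum_mono) (use x finS in auto)
    then have min: "s * y x \<le> sum y S" by (simp add: s_def)
    have card: "card (S - {x}) = card S - 1" using x(1) finS by simp
    have sum: "sum y (S - {x}) = sum y S - y x" using x(1) finS by (simp add: sum_diff1)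
    have s1: "s \<ge> 1" using pos by (simp add: s_def)
    have "s * ((s - 1) * sum y A) = (s - 1) * (s * sum y A)" by simp
    also have "\<dots> \<le> (s - 1) * (real (card A) * sum y S)"
      using s1 S(3) by (intro mult_left_mono) (simp_all add: s_def)
    also have "\<dots> = real (card A) * (s * sum y S - sum y S)" by (simp add: algebra_simps)
    also have "\<dots> \<le> real (card A) * (s * sum y S - s * y x)"
      using min by (intro mult_left_mono) simp_all
    also have "\<dots> = s * (real (card A) * (sum y S - y x))" by (simp add: algebra_simps)
    finally have "(s - 1) * sum y A \<le> real (card A) * (sum y S - y x)"
      using s1 by simp
    moreover have "real (card (S - {x})) = s - 1" using card pos by (simp add: s_def of_nat_diff)
    ultimately have "real (card (S - {x})) * sum y A \<le> real (card A) * sum y (S - {x})"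
      by (simp only: sum)
    moreover have "card (S - {x}) = card A - Suc j" using card S(2) by simp
    moreover have "S - {x} \<subseteq> A" using S(1) by blast
    ultimately show ?case by blast
  qed
  from this[of "card A - k"] show thesis using that assms(2) by auto
qed

text \<open>Take \<open>b\<close> equal to q + 1 on a set S of \<open>k\<close> above-average
  entries and to q elsewhere. After multiplication by (q + 1)(q + 2) the sum becomes q + 2 times the
  total minus the part on S, which is at least k/n of the total.\<close>

lemma balanced_weights_bound:
  fixes y :: "'n::finite \<Rightarrow> real"
  assumes "k \<le> CARD('n)"
    and le: "\<And>b :: 'n \<Rightarrow> nat. (\<Sum>i\<in>UNIV. b i) = q * CARD('n) + k \<Longrightarrow>
      c \<le> (\<Sum>i\<in>UNIV. y i / real (b i + 1))"
  shows "c * (real CARD('n) * (real q + 1) * (real q + 2)) \<le>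
    (\<Sum>i\<in>UNIV. y i) * (real CARD('n) * (real q + 2) - real k)"
proof -
  let ?n = "real CARD('n)"
  obtain S :: "'n set" where S: "card S = k" "real k * sum y UNIV \<le> ?n * sum y S"
    using subset_above_average[OF finite assms(1), of y] by blast
  define b where "b i = q + (if i \<in> S then 1 else 0)" for i
  have "(\<Sum>i\<in>UNIV. b i) = q * CARD('n) + k"
    by (simp add: b_def sum.distrib S(1) flip: sum.inter_filter)
  then have "c \<le> (\<Sum>i\<in>UNIV. y i / real (b i + 1))" by (rule le)
  then have "c * ((real q + 1) * (real q + 2)) \<le>
      (\<Sum>i\<in>UNIV. y i / real (b i + 1)) * ((real q + 1) * (real q + 2))"
    by (intro mult_right_mono) simp_all
  also have "\<dots> = (\<Sum>i\<in>UNIV. (real q + 2) * y i - (if i \<in> S then y i else 0))"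
    unfolding sum_distrib_right
  proof (rule sum.cong[OF refl])
    fix i
    show "y i / real (b i + 1) * ((real q + 1) * (real q + 2)) =
        (real q + 2) * y i - (if i \<in> S then y i else 0)"
      by (auto simp: b_def field_simps)
  qed
  also have "\<dots> = (real q + 2) * sum y UNIV - sum y S"
    by (simp add: sum_subtractf sum_distrib_left sum.If_cases)
  finally have "?n * (c * ((real q + 1) * (real q + 2))) \<le> ?n * ((real q + 2) * sum y UNIV - sum y S)"
    by (intro mult_left_mono) simp_all
  also have "\<dots> \<le> sum y UNIV * (?n * (real q + 2) - real k)"
    using S(2) by (simp add: algebra_simps)
  finally show ?thesis by (simp add: ac_simps)
qed

text \<open>The chosen decomposition does not depend on the exponent, so a single one serves all
  powers.\<close>

lemma irreducible_power_decomposition: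
  fixes I :: "('n::{finite,linorder}, 'k::idom) mpoly set"
  assumes "is_monomial_ideal I" "I \<noteq> UNIV"
  obtains \<J> where "is_irreducible_decomposition I \<J>"
    "\<And>m. irreducible_power I m = (\<Inter>J\<in>\<J>. ideal_power J m)"
proof
  show "is_irreducible_decomposition I (SOME \<J>. is_irreducible_decomposition I \<J>)"
    using irreducible_decomposition_exists[OF assms] by (rule someI_ex)
qed (simp add: irreducible_power_def)

lemma irreducible_power_degree_bound:
  fixes I :: "('n::{finite,linorder}, 'k::idom) mpoly set"
  assumes mon: "is_monomial_ideal I" and "I \<noteq> UNIV"
    and d: "initial_degree I = q * CARD('n) + k + 1" and k: "k \<le> CARD('n)"
    and f: "f \<in> irreducible_power I m" "f \<noteq> 0"
  shows "real m * (real CARD('n) * (real q + 1) * (real q + 2)) \<le>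
    real (total_degree f) * (real CARD('n) * (real q + 2) - real k)"
proof -
  obtain \<J> where dec: "is_irreducible_decomposition I \<J>"
      and pow: "\<And>m. irreducible_power I m = (\<Inter>J\<in>\<J>. ideal_power J m)"
    using irreducible_power_decomposition[OF assms(1,2)] by blast
  obtain t where t: "t \<in> keys f" using f(2) by (metis keys_eq_empty equals0I)
  \<comment> \<open>This is shown for every \<open>b\<close> of degree one below the initial degree;
    the \<open>b\<close> that is used is picked afterwards, depending on \<open>t\<close>.\<close>
  have "real m \<le> (\<Sum>i\<in>UNIV. real (lookup t i) / real (b i + 1))"
    if b: "(\<Sum>i\<in>UNIV. b i) = q * CARD('n) + k" for b :: "'n \<Rightarrow> nat"
  proof -
    let ?b = "Abs_poly_mapping b"
    have "total_degree (single ?b (1::'k)) < initial_degree I"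
      using b by (simp add: mdeg_def d)
    moreover have "single ?b (1::'k) \<noteq> 0" by (metis keys_single keys_zero insert_not_empty zero_neq_one)
    ultimately have "single ?b 1 \<notin> I" using initial_degree_le leD by blast
    then obtain J where J: "J \<in> \<J>" "single ?b 1 \<notin> J"
      using dec unfolding is_irreducible_decomposition_def by blast
    obtain a where a: "J = pure_ideal a 1" using component_is_pure[OF dec J(1)] .
    have "weight a ?b = 0" using J(2) by (simp add: a mem_pure_ideal_iff)
    then have ba: "b i < a i" if "a i > 0" for i using that by (simp add: weight_eq_0_iff)
    have "f \<in> ideal_power J m" using f(1) J(1) unfolding pow by blast
    then have "f \<in> pure_ideal a m" by (simp only: a ideal_power_pure_ideal)
    then have "m \<le> weight a t" using t by (simp add: mem_pure_ideal_iff)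
    then have "real m \<le> (\<Sum>i\<in>UNIV. real (lookup t i div a i))"
      unfolding weight_def by (simp flip: of_nat_sum)
    also have "\<dots> \<le> (\<Sum>i\<in>UNIV. real (lookup t i) / real (b i + 1))"
    proof (rule sum_mono)
      fix i
      show "real (lookup t i div a i) \<le> real (lookup t i) / real (b i + 1)"
      proof (cases "a i = 0")
        case False
        have "real (lookup t i div a i) \<le> real (lookup t i) / real (a i)"
          by (rule of_nat_div_le_of_nat)
        also have "\<dots> \<le> real (lookup t i) / real (b i + 1)"
          using ba[of i] False by (intro divide_left_mono) auto
        finally show ?thesis .
      qed simp
    qed
    finally show ?thesis .
  qed
  then have "real m * (real CARD('n) * (real q + 1) * (real q + 2)) \<le>
      (\<Sum>i\<in>UNIV. real (lookup t i)) * (real CARD('n) * (real q + 2) - real k)"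
    by (rule balanced_weights_bound[OF k])
  also have "\<dots> = real (mdeg t) * (real CARD('n) * (real q + 2) - real k)"
    by (simp add: mdeg_def)
  also have "\<dots> \<le> real (total_degree f) * (real CARD('n) * (real q + 2) - real k)"
  proof (rule mult_right_mono)
    have "real k \<le> real CARD('n) * 1" using k by simp
    also have "\<dots> \<le> real CARD('n) * (real q + 2)" by (intro mult_left_mono) simp_all
    finally show "0 \<le> real CARD('n) * (real q + 2) - real k" by simp
  qed (use mdeg_le_total_degree[OF t] in simp)
  finally show ?thesis .
qed

text \<open>An element of degree 0 has the term 1, which forces a monomial ideal to be the whole
  ring.\<close>

lemma initial_degree_pos:
  fixes I :: "('n::finite, 'k::comm_ring_1) mpoly set"
  assumes "is_monomial_ideal I" "I \<noteq> UNIV" "f \<in> I" "f \<noteq> 0"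
  shows "initial_degree I > 0"
proof (rule ccontr)
  assume "\<not> initial_degree I > 0"
  obtain U where U: "upset U" "I = keys_in U" using assms(1) is_monomial_ideal_iff by blast
  obtain g where g: "g \<in> I" "g \<noteq> 0" "total_degree g = initial_degree I"
    using initial_degree_attained[OF assms(3,4)] .
  then obtain t where t: "t \<in> keys g" by (metis keys_eq_empty equals0I)
  then have "mdeg t = 0"
    using mdeg_le_total_degree[OF t] g(3) \<open>\<not> initial_degree I > 0\<close> by simp
  then have "t = 0" by (intro poly_mapping_eqI) (simp add: mdeg_def)
  then have "0 \<in> U" using g(1) t by (auto simp: U(2) keys_in_def)
  then show False using assms(2) U keys_in_eq_UNIV_iff by blast
qed

section \<open>Waldschmidt constants\<close>

text \<open>\<open>lim\<close> is informative only once convergence is known; the powers of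
  \<open>f\<close> provide the nonzero elements for subadditivity.\<close>

lemma tendsto_waldschmidt_constant:
  fixes I :: "('n::{finite,linorder}, 'k::field) mpoly set"
  assumes "f \<in> I" "f \<noteq> 0"
  shows "(\<lambda>m. real (initial_degree (symbolic_power I m)) / real m) \<longlonglongrightarrow> waldschmidt_constant I"
proof -
  have ne: "f ^ m \<in> symbolic_power I m" "f ^ m \<noteq> 0" for m
    using power_mem_ideal_power[OF assms(1)] ideal_power_subset_symbolic_power assms(2) by auto
  have "convergent (\<lambda>m. real (initial_degree (symbolic_power I m)) / real m)"
    by (rule subadditive_convergent, rule initial_degree_subadditive[OF ne ne])
      (rule mult_mem_symbolic_power_add)
  then show ?thesis unfolding waldschmidt_constant_def by (simp add: convergent_LIMSEQ_iff)
qed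

lemma symbolic_power_subset_irreducible_power:
  fixes I :: "('n::{finite,linorder}, 'k::idom) mpoly set"
  assumes "is_monomial_ideal I" "I \<noteq> UNIV"
  shows "symbolic_power I m \<subseteq> irreducible_power I m"
  using irreducible_power_decomposition[OF assms] symbolic_power_subset_component_power
  by (metis INT_greatest)

lemma power_mem_irreducible_power:
  fixes I :: "('n::{finite,linorder}, 'k::idom) mpoly set"
  assumes "is_monomial_ideal I" "I \<noteq> UNIV" "f \<in> I"
  shows "f ^ m \<in> irreducible_power I m"
  using power_mem_ideal_power[OF assms(3)] ideal_power_subset_symbolic_power
    symbolic_power_subset_irreducible_power[OF assms(1,2)] by blast

lemma tendsto_naive_waldschmidt_constant:
  fixes I :: "('n::{finite,linorder}, 'k::field) mpoly set"
  assumes "is_monomial_ideal I" "I \<noteq> UNIV" "f \<in> I" "f \<noteq> 0"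
  shows "(\<lambda>m. real (initial_degree (irreducible_power I m)) / real m) \<longlonglongrightarrow> naive_waldschmidt_constant I"
proof -
  have ne: "f ^ m \<in> irreducible_power I m" "f ^ m \<noteq> 0" for m
    using power_mem_irreducible_power[OF assms(1-3)] assms(4) by auto
  have "g * h \<in> irreducible_power I (m + k)"
    if "g \<in> irreducible_power I m" "h \<in> irreducible_power I k" for g h m k
    using that unfolding irreducible_power_def by (auto intro: mult_mem_ideal_power_add)
  then have "convergent (\<lambda>m. real (initial_degree (irreducible_power I m)) / real m)"
    by (intro subadditive_convergent, intro initial_degree_subadditive[OF ne ne])
  then show ?thesis unfolding naive_waldschmidt_constant_def by (simp add: convergent_LIMSEQ_iff)
qed

theorem theorem4p29:
  fixes I :: "('n::{finite,linorder}, 'k::field) mpoly set"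
    and n d k :: nat
  assumes "n = CARD('n)"
    and "is_monomial_ideal I" and "I \<noteq> {0}" and "I \<noteq> UNIV"
    and "initial_degree I = d"
    and "k < n" and "[int d - 1 = int k] (mod int n)"
  shows "real (initial_degree I) \<ge> waldschmidt_constant I
    \<and> waldschmidt_constant I \<ge> naive_waldschmidt_constant I
    \<and> naive_waldschmidt_constant I \<ge>
        (real n + real d - 1 - real k) * (2 * real n + real d - 1 - real k)
          / (real n * (2 * real n + real d - 1 - 2 * real k))
    \<and> (real n + real d - 1 - real k) * (2 * real n + real d - 1 - real k)
          / (real n * (2 * real n + real d - 1 - 2 * real k)) \<ge>
        real_of_int \<lfloor>(real (initial_degree I) + real n - 1) / real n\<rfloor>"
proof -
  obtain U where U: "upset U" "I = keys_in U" using assms(2) is_monomial_ideal_iff by blast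
  have "0 \<in> I" by (simp add: U keys_in_def)
  then obtain f0 where "f0 \<in> I" "f0 \<noteq> 0" using assms(3) by blast
  then obtain f where f: "f \<in> I" "f \<noteq> 0" "total_degree f = d"
    using initial_degree_attained assms(5) by metis
  note sym_lim = tendsto_waldschmidt_constant[OF f(1,2)]
  note irr_lim = tendsto_naive_waldschmidt_constant[OF assms(2,4) f(1,2)]
  have fm: "f ^ m \<in> symbolic_power I m" "f ^ m \<in> irreducible_power I m" "f ^ m \<noteq> 0" for m
    using power_mem_ideal_power[OF f(1)] ideal_power_subset_symbolic_power
      power_mem_irreducible_power[OF assms(2,4) f(1)] f(2) by auto

  have "d > 0" using initial_degree_pos[OF assms(2,4) f(1,2)] assms(5) by simp
  define q where "q = (d - 1) div n"
  have "(int d - 1) mod int n = int k"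
    using assms(6,7) by (simp add: cong_def)
  moreover have "int d - 1 = int (d - 1)" using \<open>d > 0\<close> by simp
  ultimately have "(d - 1) mod n = k" by (metis of_nat_eq_iff of_nat_mod)
  then have "d - 1 = q * n + k" unfolding q_def by (metis div_mult_mod_eq)
  then have d: "d = q * n + k + 1" using \<open>d > 0\<close> by simp

  \<comment> \<open>With \<open>d = q * n + k + 1\<close> the fraction in the claim simplifies to
    \<open>B\<close>.\<close>
  define D where "D = real n * (real q + 2) - real k"
  define B where "B = real n * (real q + 1) * (real q + 2) / D"
  have n: "real n > 0" using assms(6) by simp
  have Dn: "D > 0"
  proof -
    have "real k < real n * 1" using assms(6) by simp
    also have "\<dots> \<le> real n * (real q + 2)" by (intro mult_left_mono) simp_all
    finally show ?thesis by (simp add: D_def)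
  qed
  have B: "(real n + real d - 1 - real k) * (2 * real n + real d - 1 - real k)
      / (real n * (2 * real n + real d - 1 - 2 * real k)) = B"
  proof -
    have e: "real n + real d - 1 - real k = real n * (real q + 1)"
      "2 * real n + real d - 1 - real k = real n * (real q + 2)"
      "2 * real n + real d - 1 - 2 * real k = D"
      by (simp_all add: d D_def algebra_simps)
    show ?thesis unfolding e B_def using n Dn by (simp add: field_simps)
  qed

  have "waldschmidt_constant I \<le> real d"
  proof (rule LIMSEQ_le_const2[OF sym_lim], intro exI[of _ 1] allI impI)
    fix m :: nat assume m: "1 \<le> m"
    have "total_degree (f ^ m) \<le> m * d" for m
    proof (induction m)
      case 0
      show ?case by (simp add: total_degree_alt mdeg_def)
    next
      case (Suc m)
      have "total_degree (f * f ^ m) \<le> total_degree f + total_degree (f ^ m)"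
        by (rule total_degree_mult_le) (use f(2) in simp)
      then show ?case using Suc f(3) by simp
    qed
    then have "initial_degree (symbolic_power I m) \<le> m * d"
      using initial_degree_le[OF fm(1,3)] order_trans by blast
    then have "real (initial_degree (symbolic_power I m)) \<le> real m * real d"
      by (simp flip: of_nat_mult)
    then show "real (initial_degree (symbolic_power I m)) / real m \<le> real d"
      using m by (simp add: divide_le_eq mult.commute)
  qed
  moreover have "naive_waldschmidt_constant I \<le> waldschmidt_constant I"
    by (rule LIMSEQ_le[OF irr_lim sym_lim], intro exI[of _ 0] allI impI divide_right_mono)
      (use initial_degree_antimono[OF symbolic_power_subset_irreducible_power[OF assms(2,4)] fm(1,3)]
        in simp_all)
  moreover have "B \<le> naive_waldschmidt_constant I"
  \<comment> \<open>The bound starts at \<open>m = 1\<close>: the quotient at 0 is 0 by convention,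
    below the positive number \<open>B\<close>.\<close>
  proof (rule LIMSEQ_le_const[OF irr_lim], intro exI[of _ 1] allI impI)
    fix m :: nat assume m: "1 \<le> m"
    obtain g where g: "g \<in> irreducible_power I m" "g \<noteq> 0"
        "total_degree g = initial_degree (irreducible_power I m)"
      using initial_degree_attained[OF fm(2,3)] .
    have "real m * (real n * (real q + 1) * (real q + 2)) \<le> real (total_degree g) * D"
      using irreducible_power_degree_bound[OF assms(2,4) _ _ g(1,2), of q k] d assms
      by (simp add: D_def)
    then have "real m * B \<le> real (total_degree g)"
      using Dn by (simp add: B_def divide_le_eq)
    then show "B \<le> real (initial_degree (irreducible_power I m)) / real m"
      using m g(3) by (simp add: le_divide_eq mult.commute)
  qed
  moreover have "real_of_int \<lfloor>(real d + real n - 1) / real n\<rfloor> \<le> B"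
  proof -
    have "\<lfloor>(real d + real n - 1) / real n\<rfloor> = int q + 1"
    proof (rule floor_unique)
      have eq: "(real d + real n - 1) / real n = real q + 1 + real k / real n"
        using n by (simp add: d field_simps)
      show "real_of_int (int q + 1) \<le> (real d + real n - 1) / real n" by (simp add: eq)
      have "real k / real n < 1" using assms(6) by simp
      then show "(real d + real n - 1) / real n < real_of_int (int q + 1) + 1" by (simp add: eq)
    qed
    \<comment> \<open>Dropping \<open>k\<close> from \<open>D\<close> only enlarges it, and with n(q
      + 2) as denominator \<open>B\<close> would be exactly q + 1.\<close>
    moreover have "(real q + 1) * D \<le> (real q + 1) * (real n * (real q + 2))"
      by (rule mult_left_mono) (simp_all add: D_def)
    then have "real q + 1 \<le> B" using Dn by (simp add: B_def le_divide_eq mult_ac)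
    ultimately show ?thesis by simp
  qed
  ultimately show ?thesis unfolding B by (simp add: assms(5))
qed

end
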